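(* Consider the control system (parametric strict feedback form) $$\dot{x}_i=f_i(x_1,\ldots,x_i)+g_i(x_1,\ldots,x_i)x_{i+1}+\sum_{j=1}^{p}\varphi_{i,j}(x_1,\ldots,x_i)\theta_j,\qquad i=1,\ldots,n,$$ where $x=(x_1,\ldots,x_n)'\in\mathbb{R}^n$ is the state, $x_{n+1}=u\in\mathbb{R}$ is the control input, $\theta=(\theta_1,\ldots,\theta_p)'\in\mathbb{R}^p$ is a vector of unknown constant parameters, and $f_i,g_i:\mathbb{R}^i\to\mathbb{R}$, $\varphi_{i,j}:\mathbb{R}^i\to\mathbb{R}$ ($i=1,\ldots,n$, $j=1,\ldots,p$) are $C^\infty$ functions with $f_i(0)=0$, $\varphi_{i,j}(0)=0$ and $g_i(x_1,\ldots,x_i)\neq0$ for all $x\in\mathbb{R}^n$. Let arbitrary constants $r\geq0$, $\alpha,\omega,\epsilon>0$ and $\gamma_j>0$, $j=1,\ldots,p$, be given. Then there exist $C^\infty$ functions $k:\mathbb{R}^n\times\mathbb{R}^p\to\mathbb{R}$, $w:\mathbb{R}^n\times\mathbb{R}^p\to\mathbb{R}^p$ with $k(0,\hat\theta)=0$, $w(0,\hat\theta)=0$ for all $\hat\theta\in\mathbb{R}^p$, and a smooth parameterized family of diffeomorphisms $T:\mathbb{R}^n\times\mathbb{R}^p\to\mathbb{R}^n$ of $\mathbb{R}^n$, such that the closed-loop system consisting of the control system and the adaptive feedback law $$\frac{d\hat\theta}{dt}=w(x,\hat\theta),\qquad u=k(x,\hat\theta)$$ satisfies the following inequalities for all $(x,\hat\theta,\theta)\in\mathbb{R}^n\times\mathbb{R}^p\times\mathbb{R}^p$: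 $$\frac{d}{dt}V(x,\hat\theta)\leq-\alpha|T(x,\hat\theta)|^2,$$ $$\frac{d}{dt}\left(\frac12|T(x,\hat\theta)|^2\right)\leq-\omega|T(x,\hat\theta)|^2+\epsilon\left(|\theta|^2-r\right)^+,$$ where $$V(x,\hat\theta):=\frac12|T(x,\hat\theta)|^2+\sum_{j=1}^p\frac{1}{2\gamma_j}(\hat\theta_j-\theta_j)^2 .$$ Moreover, the following properties hold for the closed-loop system: (i) the set $\{(0,\hat\theta):\hat\theta\in\mathbb{R}^p\}$ is the set of equilibrium points; (ii) the equilibrium point $(x,\hat\theta)=(0,\theta)$ is Lyapunov stable; (iii) for every initial condition the solution $(x(t),\hat\theta(t))$ is bounded, and the closed-loop system is Lagrange stable; (iv) the closed-loop system with output $Y=x$ is GAOS, and every solution satisfies $\lim_{t\to+\infty}x(t)=0$; (v) the closed-loop system with output $Y=x$ is UGAOS when $|\theta|\leq\sqrt r$; (vi) the closed-loop system is UGAOS for every output $Y=h(x,\hat\theta,\theta)$ for which there exists a function $b\in K_\infty$ with $$|h(x,\hat\theta,\theta)|\leq b\left(\left(|T(x,\hat\theta)|^2-\omega^{-1}\epsilon\left(|\theta|^2-r\right)^+\right)^+\right).$$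
   Context: Notation: $(s)^+:=\max(s,0)$ for $s\in\mathbb{R}$; $|\cdot|$ is the Euclidean norm; $'$ denotes transpose; $\mathbb{R}_+=[0,+\infty)$; $K_\infty$ is the class of continuous, strictly increasing, unbounded functions $b:\mathbb{R}_+\to\mathbb{R}_+$ with $b(0)=0$. $\frac{d}{dt}$ of a function of $(x,\hat\theta)$ denotes its derivative along the closed-loop vector field with $\theta$ constant (so $\frac{d}{dt}V$ and $\frac{d}{dt}(\frac12|T|^2)$ are functions of $(x,\hat\theta,\theta)$). The functions $k,w,T$ do not depend on $\theta$. Smooth parameterized family of diffeomorphisms of $\mathbb{R}^n$: a $C^\infty$ map $T:\mathbb{R}^n\times\mathbb{R}^p\to\mathbb{R}^n$ with $T(0,\theta)=0$ for all $\theta\in\mathbb{R}^p$ such that there exists a $C^\infty$ map $T^{-1}:\mathbb{R}^n\times\mathbb{R}^p\to\mathbb{R}^n$ with $T(T^{-1}(x,\theta),\theta)=T^{-1}(T(x,\theta),\theta)=x$ for all $(x,\theta)\in\mathbb{R}^n\times\mathbb{R}^p$. Output stability notions: let $\dot\xi=F(\xi)$, $\xi\in\mathbb{R}^N$, be a forward complete system (all solutions exist for all $t\ge0$) with $F$ locally Lipschitz, $F(0)=0$, and output $Y=H(\xi)$, where $H:\mathbb{R}^N\to\mathbb{R}^m$ is continuous with $H(0)=0$. Let $Y(t,\xi_0)$ be the output at time $t$ along the solution with $\xi(0)=\xi_0$, and $B_R=\{\xi\in\mathbb{R}^N:|\xi|<R\}$. The system is: - Lagrange output stable if for every $R>0$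 the set $\{|Y(t,\xi_0)|:\xi_0\in B_R,\ t\geq0\}$ is bounded; - Lyapunov output stable if for every $\varepsilon>0$ there exists $\eta(\varepsilon)>0$ such that for all $\xi_0\in B_{\eta(\varepsilon)}$, $|Y(t,\xi_0)|\leq\varepsilon$ for all $t\ge0$; - Globally Asymptotically Output Stable (GAOS) if it is Lagrange and Lyapunov output stable and $\lim_{t\to+\infty}Y(t,\xi_0)=0$ for all $\xi_0\in\mathbb{R}^N$; - Uniformly Globally Asymptotically Output Stable (UGAOS) if it is Lagrange and Lyapunov output stable and for every $\varepsilon,R>0$ there exists $\tau(\varepsilon,R)>0$ such that for all $\xi_0\in B_R$, $|Y(t,\xi_0)|\leq\varepsilon$ for all $t\geq \tau(\varepsilon,R)$. When the word "output" is omitted in "Lagrange stable", the output is understood to be the regulated state $x$ of the plant. Lyapunov stability of an equilibrium point in (ii) is the usual notion for the full state $(x,\hat\theta)$. For each fixed $\theta$, these notions are applied to the closed-loop system with the equilibrium $(0,\theta)$ shifted to the origin, i.e. with $\xi=(x,\hat\theta-\theta)\in\mathbb{R}^{n+p}$. Outputs $h$ are continuous. *)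

theory Defs
  imports "HOL-Analysis.Analysis"
begin

section \<open>Smooth maps and class K-infinity\<close>

text \<open>
  \<open>C_diff k f\<close>: \<open>f\<close> is \<open>k\<close> times continuously differentiable on the whole space.  On a
  finite-dimensional space, continuity of all iterated directional derivatives is the
  usual continuity of the iterated derivative, so this is \<open>C\<^sup>k\<close> in the usual sense.
\<close>

primrec C_diff :: "nat \<Rightarrow> ('a::euclidean_space \<Rightarrow> 'b::euclidean_space) \<Rightarrow> bool" where
  "C_diff 0 f \<longleftrightarrow> continuous_on UNIV f"
| "C_diff (Suc k) f \<longleftrightarrow>
     (\<forall>x. f differentiable (at x)) \<and>
     (\<forall>v. C_diff k (\<lambda>x. frechet_derivative f (at x) v))"

definition smooth :: "('a::euclidean_space \<Rightarrow> 'b::euclidean_space) \<Rightarrow> bool" where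
  "smooth f \<longleftrightarrow> (\<forall>k. C_diff k f)"

definition class_K_inf :: "(real \<Rightarrow> real) \<Rightarrow> bool" where
  "class_K_inf b \<longleftrightarrow>
     continuous_on {0..} b \<and> strict_mono_on {0..} b \<and> b 0 = 0 \<and> (\<forall>M. \<exists>s\<ge>0. b s > M)"

definition smooth_diffeo_family ::
    "('a::euclidean_space \<times> 'b::euclidean_space \<Rightarrow> 'a) \<Rightarrow> bool" where
  "smooth_diffeo_family T \<longleftrightarrow>
     smooth T \<and> (\<forall>\<theta>. T (0, \<theta>) = 0) \<and>
     (\<exists>S. smooth S \<and> (\<forall>x \<theta>. T (S (x, \<theta>), \<theta>) = x \<and> S (T (x, \<theta>), \<theta>) = x))"


section \<open>Autonomous systems and output stability\<close>

definition solution :: "('a::real_normed_vector \<Rightarrow> 'a) \<Rightarrow> (real \<Rightarrow> 'a) \<Rightarrow> bool" where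
  "solution F \<xi> \<longleftrightarrow> (\<forall>t\<ge>0. (\<xi> has_vector_derivative F (\<xi> t)) (at t within {0..}))"

text \<open>
  For the locally Lipschitz \<open>F\<close> considered below, solutions are unique, so the existence
  of a solution on \<open>{0..}\<close> from every initial state says that all maximal solutions are
  defined for all \<open>t \<ge> 0\<close>.
\<close>

definition forward_complete :: "('a::real_normed_vector \<Rightarrow> 'a) \<Rightarrow> bool" where
  "forward_complete F \<longleftrightarrow> (\<forall>\<xi>\<^sub>0. \<exists>\<xi>. solution F \<xi> \<and> \<xi> 0 = \<xi>\<^sub>0)"

definition lie_derivative ::
    "('a::real_normed_vector \<Rightarrow> real) \<Rightarrow> ('a \<Rightarrow> 'a) \<Rightarrow> 'a \<Rightarrow> real" where
  "lie_derivative V F z = frechet_derivative V (at z) (F z)"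

definition equilibria :: "('a::real_normed_vector \<Rightarrow> 'a) \<Rightarrow> 'a set" where
  "equilibria F = {z. F z = 0}"

definition lyapunov_stable :: "('a::real_normed_vector \<Rightarrow> 'a) \<Rightarrow> 'a \<Rightarrow> bool" where
  "lyapunov_stable F e \<longleftrightarrow>
     e \<in> equilibria F \<and>
     (\<forall>\<epsilon>>0. \<exists>\<delta>>0. \<forall>\<xi>\<^sub>0\<in>ball e \<delta>.
        (\<exists>\<xi>. solution F \<xi> \<and> \<xi> 0 = \<xi>\<^sub>0) \<and>
        (\<forall>\<xi>. solution F \<xi> \<and> \<xi> 0 = \<xi>\<^sub>0 \<longrightarrow> (\<forall>t\<ge>0. dist (\<xi> t) e < \<epsilon>)))"

text \<open>
  An output with values in a Euclidean space is given by its coordinates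
  \<open>H \<xi> i\<close>, \<open>i \<in> I\<close>, with \<open>I\<close> finite; its Euclidean norm is \<open>L2_set (H \<xi>) I\<close>.  The index
  set is a term rather than a type so that the number of outputs can be quantified
  inside a formula.
\<close>

definition output_system ::
    "('a::euclidean_space \<Rightarrow> 'a) \<Rightarrow> ('a \<Rightarrow> 'i \<Rightarrow> real) \<Rightarrow> 'i set \<Rightarrow> bool" where
  "output_system F H I \<longleftrightarrow>
     local_lipschitz (UNIV :: real set) UNIV (\<lambda>_. F) \<and> F 0 = 0 \<and> forward_complete F \<and>
     finite I \<and> (\<forall>i\<in>I. continuous_on UNIV (\<lambda>\<xi>. H \<xi> i) \<and> H 0 i = 0)"

definition lagrange_output_stable ::
    "('a::euclidean_space \<Rightarrow> 'a) \<Rightarrow> ('a \<Rightarrow> 'i \<Rightarrow> real) \<Rightarrow> 'i set \<Rightarrow> bool" where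
  "lagrange_output_stable F H I \<longleftrightarrow>
     output_system F H I \<and>
     (\<forall>R>0. bounded {L2_set (H (\<xi> t)) I | \<xi> t. solution F \<xi> \<and> \<xi> 0 \<in> ball 0 R \<and> t \<ge> 0})"

definition lyapunov_output_stable ::
    "('a::euclidean_space \<Rightarrow> 'a) \<Rightarrow> ('a \<Rightarrow> 'i \<Rightarrow> real) \<Rightarrow> 'i set \<Rightarrow> bool" where
  "lyapunov_output_stable F H I \<longleftrightarrow>
     output_system F H I \<and>
     (\<forall>\<epsilon>>0. \<exists>\<eta>>0. \<forall>\<xi>. solution F \<xi> \<and> \<xi> 0 \<in> ball 0 \<eta> \<longrightarrow>
        (\<forall>t\<ge>0. L2_set (H (\<xi> t)) I \<le> \<epsilon>))"

definition GAOS ::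
    "('a::euclidean_space \<Rightarrow> 'a) \<Rightarrow> ('a \<Rightarrow> 'i \<Rightarrow> real) \<Rightarrow> 'i set \<Rightarrow> bool" where
  "GAOS F H I \<longleftrightarrow>
     lagrange_output_stable F H I \<and> lyapunov_output_stable F H I \<and>
     (\<forall>\<xi>. solution F \<xi> \<longrightarrow> (\<forall>i\<in>I. ((\<lambda>t. H (\<xi> t) i) \<longlongrightarrow> 0) at_top))"

definition UGAOS ::
    "('a::euclidean_space \<Rightarrow> 'a) \<Rightarrow> ('a \<Rightarrow> 'i \<Rightarrow> real) \<Rightarrow> 'i set \<Rightarrow> bool" where
  "UGAOS F H I \<longleftrightarrow>
     lagrange_output_stable F H I \<and> lyapunov_output_stable F H I \<and>
     (\<forall>\<epsilon>>0. \<forall>R>0. \<exists>\<tau>>0. \<forall>\<xi>. solution F \<xi> \<and> \<xi> 0 \<in> ball 0 R \<longrightarrow>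
        (\<forall>t\<ge>\<tau>. L2_set (H (\<xi> t)) I \<le> \<epsilon>))"


section \<open>Parametric strict feedback systems\<close>

text \<open>The synonym only bypasses the sort \<open>finite\<close> that the notation \<open>real^'n\<close> attaches to \<open>'n\<close>,
  which would clash with \<open>{finite, linorder}\<close>.\<close>

type_synonym 'n rvec = "real^'n"

text \<open>
  The indices \<open>1, \<dots>, n\<close> are the elements of a finite linearly ordered type \<open>'n\<close>.  A function of
  \<open>(x\<^sub>1, \<dots>, x\<^sub>i)\<close> is represented by a function of \<open>x\<close> that depends only on the coordinates
  up to \<open>i\<close>; it is smooth on \<open>\<real>\<^sup>i\<close> iff it is smooth as a function on \<open>\<real>\<^sup>n\<close>.
\<close>

definition depends_upto :: "'n::{finite,linorder} \<Rightarrow> ('n rvec \<Rightarrow> real) \<Rightarrow> bool" where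
  "depends_upto i F \<longleftrightarrow> (\<forall>x y. (\<forall>j\<le>i. x $ j = y $ j) \<longrightarrow> F x = F y)"

text \<open>\<open>next_coord i x u\<close> is \<open>x\<^bsub>i+1\<^esub>\<close>, with \<open>x\<^bsub>n+1\<^esub> = u\<close>.\<close>

definition next_coord :: "'n::{finite,linorder} \<Rightarrow> 'n rvec \<Rightarrow> real \<Rightarrow> real" where
  "next_coord i x u = (if {j. i < j} = {} then u else x $ Min {j. i < j})"

definition strict_feedback ::
    "('n::{finite,linorder} \<Rightarrow> 'n rvec \<Rightarrow> real) \<Rightarrow> ('n \<Rightarrow> 'n rvec \<Rightarrow> real) \<Rightarrow> ('n \<Rightarrow> 'p::finite \<Rightarrow> 'n rvec \<Rightarrow> real) \<Rightarrow>
     'p rvec \<Rightarrow> 'n rvec \<Rightarrow> real \<Rightarrow> 'n rvec" where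
  "strict_feedback f g \<phi> \<theta> x u =
     (\<chi> i. f i x + g i x * next_coord i x u + (\<Sum>j\<in>UNIV. \<phi> i j x * \<theta> $ j))"

definition closed_loop ::
    "('n::{finite,linorder} \<Rightarrow> 'n rvec \<Rightarrow> real) \<Rightarrow> ('n \<Rightarrow> 'n rvec \<Rightarrow> real) \<Rightarrow> ('n \<Rightarrow> 'p::finite \<Rightarrow> 'n rvec \<Rightarrow> real) \<Rightarrow>
     ('n rvec \<times> 'p rvec \<Rightarrow> real) \<Rightarrow> ('n rvec \<times> 'p rvec \<Rightarrow> 'p rvec) \<Rightarrow> 'p rvec \<Rightarrow>
     'n rvec \<times> 'p rvec \<Rightarrow> 'n rvec \<times> 'p rvec" where
  "closed_loop f g \<phi> k w \<theta> = (\<lambda>(x, h\<theta>). (strict_feedback f g \<phi> \<theta> x (k (x, h\<theta>)), w (x, h\<theta>)))"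

text \<open>The closed loop in the coordinates \<open>\<xi> = (x, h\<theta> - \<theta>)\<close>, where \<open>h\<theta>\<close> is the parameter
  estimate.\<close>

definition shifted_closed_loop ::
    "('n::{finite,linorder} \<Rightarrow> 'n rvec \<Rightarrow> real) \<Rightarrow> ('n \<Rightarrow> 'n rvec \<Rightarrow> real) \<Rightarrow> ('n \<Rightarrow> 'p::finite \<Rightarrow> 'n rvec \<Rightarrow> real) \<Rightarrow>
     ('n rvec \<times> 'p rvec \<Rightarrow> real) \<Rightarrow> ('n rvec \<times> 'p rvec \<Rightarrow> 'p rvec) \<Rightarrow> 'p rvec \<Rightarrow>
     'n rvec \<times> 'p rvec \<Rightarrow> 'n rvec \<times> 'p rvec" where
  "shifted_closed_loop f g \<phi> k w \<theta> = (\<lambda>\<xi>. closed_loop f g \<phi> k w \<theta> (\<xi> + (0, \<theta>)))"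

definition V_fun ::
    "('n::finite rvec \<times> 'p::finite rvec \<Rightarrow> 'n rvec) \<Rightarrow> ('p \<Rightarrow> real) \<Rightarrow> 'p rvec \<Rightarrow>
     'n rvec \<times> 'p rvec \<Rightarrow> real" where
  "V_fun T \<gamma> \<theta> = (\<lambda>(x, h\<theta>).
     1/2 * (norm (T (x, h\<theta>)))\<^sup>2 + (\<Sum>j\<in>UNIV. 1 / (2 * \<gamma> j) * (h\<theta> $ j - \<theta> $ j)\<^sup>2))"

end

theory Submission
  imports Defs
begin

text \<open>
  The design is adaptive backstepping with tuning functions, strengthened by nonlinear damping.
  Virtual controls \<open>\<beta>\<^sub>i\<close> depending on \<open>(x\<^sub>1, \<dots>, x\<^sub>i)\<close> and on the estimate are built one
  after the other; \<open>\<beta>\<^sub>i\<close> is the value that \<open>x\<^bsub>i+1\<^esub>\<close> should have, the last one is the control \<open>k\<close>,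
  and \<open>T\<close> collects the errors \<open>z\<^sub>i = x\<^sub>i - \<beta>\<^bsub>i-1\<^esub>\<close>.  This \<open>T\<close> is triangular with unit diagonal, hence
  a product of shears, hence a smooth family of diffeomorphisms
  (\<open>smooth_diffeo_family_triangular\<close>).

  In these coordinates the unknown parameter enters \<open>z\<^sub>i\<close> linearly, through regressors \<open>W\<^sub>i\<close> that
  vanish at \<open>x = 0\<close>.  Put \<open>U = \<Sum> z\<^sub>i W\<^sub>i\<close> and let the estimate of \<open>\<theta>\<^sub>j\<close> move with speed \<open>\<gamma>\<^sub>j U\<^sub>j\<close>;
  then the derivative of \<open>V\<close> does not contain \<open>\<theta>\<close> any more.  The estimate moves the virtual controls too,
  which couples \<open>z\<^sub>i\<close> with every \<open>z\<^sub>l\<close>; each coupling is cancelled at the step with the larger index,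
  where all its ingredients are already known (\<open>sum_coupling_by_larger_index\<close>).  The outcome, with
  freely chosen gains \<open>c\<^sub>i\<close> that may depend on \<open>(x\<^sub>1, \<dots>, x\<^sub>i)\<close> and on the estimate, is
  \<open>dV/dt = - \<Sum> c\<^sub>i z\<^sub>i\<^sup>2\<close> and \<open>d(|T|\<^sup>2/2)/dt = - \<Sum> c\<^sub>i z\<^sub>i\<^sup>2 + U \<bullet> (\<theta> - estimate)\<close>
  (\<open>lie_V\<close>, \<open>lie_errs\<close>).

  The second inequality of the theorem has to absorb \<open>U \<bullet> (\<theta> - estimate)\<close> for every \<open>\<theta>\<close>.
  Young's inequality (\<open>robust_young\<close>) pays for \<open>|\<theta>|\<close> beyond \<open>sqrt r\<close> with
  \<open>\<epsilon> (|\<theta>|\<^sup>2 - r)\<^sup>+\<close> and \<open>|U|\<^sup>2 / (4 \<epsilon>)\<close>, which is quadratic in \<open>z\<close>.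
  What is left is \<open>|U|\<close> times a known function, a sum of terms \<open>|z\<^sub>i| |W\<^sub>i|\<close>.  Hadamard's lemma shows
  that \<open>|W\<^sub>i|\<^sup>2\<close> is at most a smooth multiple of \<open>z\<^sub>1\<^sup>2 + \<dots> + z\<^sub>i\<^sup>2\<close> (\<open>error_bound\<close>), so those terms are
  quadratic in \<open>z\<close> as well and a large smooth gain \<open>c\<^sub>i\<close> dominates them (\<open>step_exists\<close>).

  The stability properties follow from the two inequalities alone.  The sublevel sets of \<open>V\<close> are compact
  and invariant, which gives global solutions, boundedness and Lyapunov stability, and the latter
  passes to every continuous output that vanishes at the equilibrium (\<open>output_stable\<close>).  Integrating the
  first inequality, with the second one bounding the growth of \<open>|T|\<^sup>2\<close>, yields \<open>T \<rightarrow> 0\<close> in the manner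
  of Barbalat's lemma.  Integrating the second one gives exponential decay of the excess of \<open>|T|\<^sup>2\<close> over
  \<open>\<epsilon> (|\<theta>|\<^sup>2 - r)\<^sup>+ / \<omega>\<close>, uniformly on bounded sets of initial states, hence the uniform statements.
\<close>

section \<open>Calculus of smooth maps\<close>

abbreviation dird :: "('a::real_normed_vector \<Rightarrow> 'b::real_normed_vector) \<Rightarrow> 'a \<Rightarrow> 'a \<Rightarrow> 'b" where
  "dird f v x \<equiv> frechet_derivative f (at x) v"

lemma C_diff_SucI:
  assumes "\<And>x. (f has_derivative f' x) (at x)" "\<And>v. C_diff k (\<lambda>x. f' x v)"
  shows "C_diff (Suc k) f"
proof -
  have "frechet_derivative f (at x) = f' x" for x
    using frechet_derivative_at[OF assms(1)] by simp
  then show ?thesis using assms by (auto simp: differentiable_def)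
qed

lemma C_diff_Suc_imp: "C_diff (Suc k) f \<Longrightarrow> C_diff k f"
proof (induction k arbitrary: f)
  case 0
  then show ?case
    by (auto intro!: differentiable_imp_continuous_on simp: differentiable_on_def
        intro: differentiable_at_withinI)
next
  case (Suc k)
  then show ?case by (metis C_diff.simps(2))
qed

lemma C_diff_has_derivative:
  "C_diff (Suc k) f \<Longrightarrow> (f has_derivative frechet_derivative f (at x)) (at x)"
  by (simp add: frechet_derivative_works)

lemma smooth_continuous: "smooth f \<Longrightarrow> continuous_on S f"
  unfolding smooth_def using C_diff.simps(1) continuous_on_subset by blast

lemma smooth_has_derivative:
  "smooth f \<Longrightarrow> (f has_derivative frechet_derivative f (at x)) (at x)"
  unfolding smooth_def by (metis C_diff.simps(2) frechet_derivative_works)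

lemma smooth_dird: "smooth f \<Longrightarrow> smooth (dird f v)"
  unfolding smooth_def by (metis C_diff.simps(2))

lemma C_diff_const: "C_diff k (\<lambda>x. c)"
  by (induction k arbitrary: c) (auto simp: frechet_derivative_const)

lemma C_diff_bounded_linear_compose:
  assumes "bounded_linear L" "C_diff k f"
  shows "C_diff k (\<lambda>x. L (f x))"
  using assms(2)
proof (induction k arbitrary: f)
  case 0
  then show ?case by (simp add: bounded_linear.continuous_on[OF assms(1)])
next
  case (Suc k)
  show ?case
  proof (rule C_diff_SucI)
    show "((\<lambda>x. L (f x)) has_derivative (\<lambda>v. L (dird f v x))) (at x)" for x
      by (rule bounded_linear.has_derivative[OF assms(1) C_diff_has_derivative[OF Suc.prems]])
    show "C_diff k (\<lambda>x. L (dird f v x))" for v using Suc by simp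
  qed
qed

lemma C_diff_bounded_linear:
  assumes "bounded_linear L"
  shows "C_diff k L"
proof (cases k)
  case 0
  then show ?thesis by (simp add: assms linear_continuous_on)
next
  case (Suc m)
  show ?thesis
    unfolding Suc
    by (rule C_diff_SucI[where f'="\<lambda>_. L"])
      (auto intro: bounded_linear_imp_has_derivative assms C_diff_const)
qed

lemma C_diff_add:
  assumes "C_diff k f" "C_diff k h"
  shows "C_diff k (\<lambda>x. f x + h x)"
  using assms
proof (induction k arbitrary: f h)
  case 0
  then show ?case by (simp add: continuous_on_add)
next
  case (Suc k)
  show ?case
  proof (rule C_diff_SucI)
    show "((\<lambda>x. f x + h x) has_derivative (\<lambda>v. dird f v x + dird h v x)) (at x)" for x
      by (intro has_derivative_add C_diff_has_derivative[OF Suc.prems(1)]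
          C_diff_has_derivative[OF Suc.prems(2)])
    show "C_diff k (\<lambda>x. dird f v x + dird h v x)" for v using Suc by simp
  qed
qed

lemma C_diff_sum:
  "(\<And>i. i \<in> I \<Longrightarrow> C_diff k (f i)) \<Longrightarrow> C_diff k (\<lambda>x. \<Sum>i\<in>I. f i x)"
  by (induction I rule: infinite_finite_induct) (auto simp: C_diff_const C_diff_add)

lemma C_diff_mult:
  fixes f h :: "'a::euclidean_space \<Rightarrow> real"
  assumes "C_diff k f" "C_diff k h"
  shows "C_diff k (\<lambda>x. f x * h x)"
  using assms
proof (induction k arbitrary: f h)
  case 0
  then show ?case by (simp add: continuous_on_mult)
next
  case (Suc k)
  show ?case
  proof (rule C_diff_SucI)
    show "((\<lambda>x. f x * h x) has_derivative (\<lambda>v. f x * dird h v x + dird f v x * h x)) (at x)" for x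
      by (intro has_derivative_mult C_diff_has_derivative[OF Suc.prems(1)]
          C_diff_has_derivative[OF Suc.prems(2)])
    show "C_diff k (\<lambda>x. f x * dird h v x + dird f v x * h x)" for v
      using Suc C_diff_Suc_imp[OF Suc.prems(1)] C_diff_Suc_imp[OF Suc.prems(2)]
      by (auto intro!: C_diff_add)
  qed
qed

text \<open>The derivative \<open>- h'(x) v / h(x)\<^sup>2\<close> is a product of the derivative of \<open>h\<close> with two copies of
  the reciprocal itself, which the induction hypothesis covers one order lower.\<close>
lemma C_diff_inverse:
  fixes h :: "'a::euclidean_space \<Rightarrow> real"
  assumes "C_diff k h" "\<And>x. h x \<noteq> 0"
  shows "C_diff k (\<lambda>x. inverse (h x))"
  using assms
proof (induction k)
  case 0
  then show ?case by (simp add: continuous_on_inverse)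
next
  case (Suc k)
  show ?case
  proof (rule C_diff_SucI)
    show "((\<lambda>x. inverse (h x)) has_derivative
        (\<lambda>v. (-1) * (inverse (h x) * dird h v x * inverse (h x)))) (at x)" for x
      using Deriv.has_derivative_inverse[OF Suc.prems(2) C_diff_has_derivative[OF Suc.prems(1)]]
      by simp
    show "C_diff k (\<lambda>x. (-1) * (inverse (h x) * dird h v x * inverse (h x)))" for v
      using Suc C_diff_Suc_imp[OF Suc.prems(1)] by (intro C_diff_mult C_diff_const) auto
  qed
qed

text \<open>In a basis, the chain rule writes the derivative as a finite sum of products of a component of
  \<open>f'\<close> with a partial derivative of \<open>h\<close> composed with \<open>f\<close>; the latter is again a composition, one
  order lower.\<close>
lemma C_diff_compose:
  fixes h :: "'b::euclidean_space \<Rightarrow> 'c::euclidean_space" and f :: "'a::euclidean_space \<Rightarrow> 'b"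
  assumes "C_diff k h" "C_diff k f"
  shows "C_diff k (\<lambda>x. h (f x))"
  using assms
proof (induction k arbitrary: h f)
  case 0
  then show ?case using continuous_on_compose2[of UNIV h UNIV f] by simp
next
  case (Suc k)
  show ?case
  proof (rule C_diff_SucI)
    have h: "(h has_derivative frechet_derivative h (at y)) (at y)" for y
      by (rule C_diff_has_derivative[OF Suc.prems(1)])
    have f: "(f has_derivative frechet_derivative f (at x)) (at x)" for x
      by (rule C_diff_has_derivative[OF Suc.prems(2)])
    have eq: "dird h u y = (\<Sum>b\<in>Basis. (u \<bullet> b) *\<^sub>R dird h b y)" for u y
    proof -
      interpret bounded_linear "frechet_derivative h (at y)"
        using h has_derivative_bounded_linear by blast
      show ?thesis
        using sum[of "\<lambda>b. (u \<bullet> b) *\<^sub>R b" Basis] by (simp add: scaleR euclidean_representation)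
    qed
    show "((\<lambda>x. h (f x)) has_derivative
        (\<lambda>v. \<Sum>b\<in>Basis. (dird f v x \<bullet> b) *\<^sub>R dird h b (f x))) (at x)" for x
      using has_derivative_compose[OF f h, of x] by (simp add: eq[symmetric])
    have 1: "C_diff k (\<lambda>x. (dird f v x \<bullet> b) * (dird h b (f x) \<bullet> c))" for v b c
      using Suc.IH[of "dird h b" f] Suc.prems C_diff_Suc_imp[OF Suc.prems(2)]
      by (intro C_diff_mult C_diff_bounded_linear_compose[OF bounded_linear_inner_left]) simp_all
    have 2: "C_diff k (\<lambda>x. (dird f v x \<bullet> b) *\<^sub>R dird h b (f x))" for v b
    proof -
      have "C_diff k (\<lambda>x. \<Sum>c\<in>Basis. ((dird f v x \<bullet> b) * (dird h b (f x) \<bullet> c)) *\<^sub>R c)"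
        by (intro C_diff_sum C_diff_bounded_linear_compose[OF bounded_linear_scaleR_left] 1)
      moreover have "(\<Sum>c\<in>Basis. (d * (y \<bullet> c)) *\<^sub>R c) = d *\<^sub>R y" for d and y :: 'c
        by (metis (no_types, lifting) euclidean_representation scaleR_scaleR scaleR_sum_right
            sum.cong)
      ultimately show ?thesis by (simp only:)
    qed
    show "C_diff k (\<lambda>x. \<Sum>b\<in>Basis. (dird f v x \<bullet> b) *\<^sub>R dird h b (f x))" for v
      by (intro C_diff_sum 2)
  qed
qed

lemma smooth_const [intro]: "smooth (\<lambda>x. c)"
  and smooth_bounded_linear: "bounded_linear L \<Longrightarrow> smooth L"
  and smooth_add [intro]: "smooth f \<Longrightarrow> smooth h \<Longrightarrow> smooth (\<lambda>x. f x + h x)"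
  and smooth_sum: "(\<And>i. i \<in> I \<Longrightarrow> smooth (F i)) \<Longrightarrow> smooth (\<lambda>x. \<Sum>i\<in>I. F i x)"
  and smooth_compose: "smooth H \<Longrightarrow> smooth f \<Longrightarrow> smooth (\<lambda>x. H (f x))"
  by (auto simp: smooth_def C_diff_const C_diff_bounded_linear C_diff_add C_diff_sum
      C_diff_compose)

lemma smooth_mult [intro]: "smooth f \<Longrightarrow> smooth h \<Longrightarrow> smooth (\<lambda>x. f x * h x)"
  and smooth_inverse: "smooth h \<Longrightarrow> (\<And>x. h x \<noteq> 0) \<Longrightarrow> smooth (\<lambda>x. inverse (h x))"
  for f h :: "'a::euclidean_space \<Rightarrow> real"
  by (auto simp: smooth_def C_diff_mult C_diff_inverse)

lemma smooth_linear_compose: "bounded_linear L \<Longrightarrow> smooth f \<Longrightarrow> smooth (\<lambda>x. L (f x))"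
  by (rule smooth_compose[OF smooth_bounded_linear])

lemma smooth_vec:
  assumes "\<And>i. smooth (\<lambda>x. f x $ i)"
  shows "smooth (f :: 'a::euclidean_space \<Rightarrow> real^'n)"
proof -
  have "bounded_linear (\<lambda>c. c *\<^sub>R axis i 1 :: real^'n)" for i
    by (rule bounded_linear_scaleR_left)
  then have "smooth (\<lambda>x. \<Sum>i\<in>UNIV. f x $ i *\<^sub>R (axis i 1 :: real^'n))"
    by (intro smooth_sum smooth_linear_compose[of "\<lambda>c. c *\<^sub>R axis _ 1"] assms)
  moreover have "f x = (\<Sum>i\<in>UNIV. f x $ i *\<^sub>R (axis i 1 :: real^'n))" for x
    by (simp add: vec_eq_iff axis_def if_distrib cong: if_cong)
  ultimately show ?thesis by simp
qed

lemma power2_norm_vec: "(norm v)\<^sup>2 = (\<Sum>j\<in>UNIV. (v $ j)\<^sup>2)" for v :: "real^'n"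
  unfolding power2_norm_eq_inner by (simp add: inner_vec_def power2_eq_square)

lemma smooth_Pair:
  assumes "smooth f" "smooth h"
  shows "smooth (\<lambda>x. (f x, h x))"
proof -
  have "smooth (\<lambda>x. (f x, 0) + (0, h x))"
    using assms by (intro smooth_add smooth_linear_compose[of "\<lambda>y. (y, 0)"]
        smooth_linear_compose[of "\<lambda>y. (0, y)"] bounded_linear_Pair bounded_linear_zero
        bounded_linear_ident)
  then show ?thesis by simp
qed

lemma smooth_Blinfun_apply:
  assumes "smooth F"
  shows "blinfun_apply (Blinfun (frechet_derivative F (at x))) = frechet_derivative F (at x)"
  by (rule bounded_linear_Blinfun_apply[OF
        has_derivative_bounded_linear[OF smooth_has_derivative[OF assms]]])

lemma smooth_has_derivative_Blinfun:
  assumes "smooth F"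
  shows "(F has_derivative blinfun_apply (Blinfun (frechet_derivative F (at x)))) (at x)"
  using smooth_has_derivative[OF assms] by (simp add: smooth_Blinfun_apply[OF assms])

lemma smooth_continuous_Blinfun:
  assumes "smooth F"
  shows "continuous_on S (\<lambda>x. Blinfun (frechet_derivative F (at x)))"
proof (rule continuous_on_blinfun_componentwise)
  fix i
  show "continuous_on S (\<lambda>x. blinfun_apply (Blinfun (frechet_derivative F (at x))) i)"
    using smooth_continuous[OF smooth_dird[OF assms]] by (simp add: smooth_Blinfun_apply[OF assms])
qed

text \<open>Differentiation under the integral sign sends the directional derivative along \<open>v\<close> of the
  parameter integral to the parameter integral of the derivative along \<open>(v, 0)\<close>, which is an
  integrand of the same kind; hence the induction on the order.\<close>
lemma smooth_integral_parameter:
  fixes F :: "'a::euclidean_space \<times> real \<Rightarrow> 'b::euclidean_space"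
  assumes "smooth F"
  shows "smooth (\<lambda>x. integral {0..1} (\<lambda>t. F (x, t)))"
proof -
  have "C_diff k (\<lambda>x. integral {0..1} (\<lambda>t. F (x, t)))" for k
    using assms
  proof (induction k arbitrary: F)
    case 0
    have "continuous_on (UNIV \<times> cbox 0 1) (\<lambda>(x, t). F (x, t))"
      using smooth_continuous[OF 0] by simp
    then show ?case
      using integral_continuous_on_param[of UNIV 0 1 "\<lambda>x t. F (x, t)"] by simp
  next
    case (Suc k)
    define P :: "'a \<Rightarrow>\<^sub>L ('a \<times> real)" where "P = Blinfun (\<lambda>v. (v, 0))"
    have P: "blinfun_apply P v = (v, 0)" for v
      unfolding P_def
      by (subst bounded_linear_Blinfun_apply)
        (auto intro!: bounded_linear_Pair bounded_linear_zero bounded_linear_ident)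
    define D where "D x t = Blinfun (frechet_derivative F (at (x, t))) o\<^sub>L P" for x t
    have D: "blinfun_apply (D x t) v = dird F (v, 0) (x, t)" for x t v
      by (simp add: D_def P smooth_Blinfun_apply[OF Suc.prems])
    have contD: "continuous_on (UNIV \<times> cbox 0 1) (\<lambda>(x, t). D x t)"
      unfolding D_def case_prod_unfold prod.collapse
      by (intro continuous_intros smooth_continuous_Blinfun Suc.prems)
    have int: "continuous_on {0..1} (\<lambda>t. H (x, t))"
      if "continuous_on UNIV H" for x :: 'a and H :: "_ \<Rightarrow> 'd::topological_space"
      by (rule continuous_on_compose2[OF that]) (auto intro!: continuous_intros)
    have cD: "continuous_on {0..1} (D x)" for x
    proof -
      have "continuous_on {0..1} (\<lambda>t. case (x, t) of (x, t) \<Rightarrow> D x t)"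
        by (rule continuous_on_compose2[OF contD]) (auto intro!: continuous_intros)
      then show ?thesis by simp
    qed
    show ?case
    proof (rule C_diff_SucI)
      show "((\<lambda>x. integral {0..1} (\<lambda>t. F (x, t))) has_derivative
          blinfun_apply (integral {0..1} (D x))) (at x)" for x
      proof -
        have "((\<lambda>x. F (x, t)) has_derivative blinfun_apply (D x t)) (at x)" for x t
        proof -
          have "((\<lambda>x. (x, t)) has_derivative (\<lambda>v. (v, 0))) (at x)"
            by (intro derivative_intros)
          note has_derivative_compose[OF this smooth_has_derivative[OF Suc.prems]]
          moreover have "blinfun_apply (D x t) = (\<lambda>v. dird F (v, 0) (x, t))" by (rule ext) (rule D)
          ultimately show ?thesis by simp
        qed
        moreover have "(\<lambda>t. F (x, t)) integrable_on {0..1}" for x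
          by (rule integrable_continuous_real[OF int[OF smooth_continuous[OF Suc.prems]]])
        ultimately show ?thesis
          using leibniz_rule[of UNIV 0 1 "\<lambda>x t. F (x, t)" D x] contD by auto
      qed
      show "C_diff k (\<lambda>x. blinfun_apply (integral {0..1} (D x)) v)" for v
      proof -
        have "blinfun_apply (integral {0..1} (D x)) v = integral {0..1} (\<lambda>t. dird F (v, 0) (x, t))"
          for x
          using blinfun_apply_integral[OF integrable_continuous_real[OF cD], of x v]
          by (simp add: D)
        then show ?thesis using Suc.IH[OF smooth_dird[OF Suc.prems]] by simp
      qed
    qed
  qed
  then show ?thesis by (simp add: smooth_def)
qed

lemma smooth_local_lipschitz:
  fixes F :: "'a::euclidean_space \<Rightarrow> 'a"
  assumes "smooth F"
  shows "local_lipschitz (UNIV :: real set) UNIV (\<lambda>_. F)"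
proof (rule c1_implies_local_lipschitz[where f' = "\<lambda>p. Blinfun (frechet_derivative F (at (snd p)))"])
  show "continuous_on (UNIV \<times> UNIV)
      (\<lambda>p :: real \<times> _. Blinfun (frechet_derivative F (at (snd p))))"
    using continuous_on_compose2[OF smooth_continuous_Blinfun[OF assms, of UNIV]
        continuous_on_snd[OF continuous_on_id]] by blast
qed (use smooth_has_derivative_Blinfun[OF assms] in auto)


section \<open>Global solutions of ordinary differential equations\<close>

lemma integral_has_vector_derivative_atLeast:
  fixes h :: "real \<Rightarrow> 'a::banach"
  assumes "continuous_on {0..} h" "0 \<le> t"
  shows "((\<lambda>t. integral {0..t} h) has_vector_derivative h t) (at t within {0..})"
proof -
  have "((\<lambda>t. integral {0..t} h) has_vector_derivative h t) (at t within {0..t + 1})"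
    using assms by (intro integral_has_vector_derivative continuous_on_subset[OF assms(1)]) auto
  moreover have "at t within {0..} = at t within {0..t + 1}"
    by (rule at_within_nhd[of t "{..<t + 1}"]) auto
  ultimately show ?thesis by simp
qed

text \<open>The weight \<open>exp (- \<kappa> t)\<close> gains a factor \<open>1 / \<kappa>\<close>.  It makes the Picard operator a contraction on the
  whole half-line, so that no gluing of local solutions is necessary.\<close>
lemma norm_weighted_integral_le:
  fixes h :: "real \<Rightarrow> 'a::euclidean_space"
  assumes "continuous_on {0..t} h" "0 \<le> t" "0 < \<kappa>" "0 \<le> B"
    and "\<And>s. 0 \<le> s \<Longrightarrow> norm (h s) \<le> B * exp (\<kappa> * s)"
  shows "norm (exp (- \<kappa> * t) *\<^sub>R integral {0..t} h) \<le> B / \<kappa>"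
proof -
  have "((\<lambda>s. B * exp (\<kappa> * s)) has_integral B / \<kappa> * exp (\<kappa> * t) - B / \<kappa> * exp (\<kappa> * 0)) {0..t}"
    using assms(2,3)
    by (intro fundamental_theorem_of_calculus)
      (auto simp: has_real_derivative_iff_has_vector_derivative[symmetric] intro!: derivative_eq_intros)
  note E = has_integral_integrable[OF this] integral_unique[OF this]
  have "norm (integral {0..t} h) \<le> integral {0..t} (\<lambda>s. B * exp (\<kappa> * s))"
    by (rule integral_norm_bound_integral[OF integrable_continuous_real[OF assms(1)] E(1)])
      (use assms(5) in auto)
  also have "\<dots> \<le> B / \<kappa> * exp (\<kappa> * t)" unfolding E(2) using assms(3,4) by simp
  finally have "exp (- \<kappa> * t) * norm (integral {0..t} h) \<le> exp (- \<kappa> * t) * (B / \<kappa> * exp (\<kappa> * t))"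
    by (intro mult_left_mono) auto
  also have "\<dots> = B / \<kappa>" by (simp add: exp_minus)
  finally show ?thesis by simp
qed

text \<open>Banach's fixed point theorem for \<open>u(t) = exp (- \<kappa> t) (y(t) - y(0))\<close> in the space of bounded
  continuous functions.\<close>
lemma lipschitz_solution_exists:
  fixes G :: "'a::euclidean_space \<Rightarrow> 'a"
  assumes lip: "L-lipschitz_on UNIV G"
  shows "\<exists>y. solution G y \<and> y 0 = y0"
proof -
  have L: "L \<ge> 0" using lip by (rule lipschitz_on_nonneg)
  \<comment> \<open>any weight above \<open>L\<close> gives the contraction factor \<open>L / \<kappa> < 1\<close>\<close>
  define \<kappa> where "\<kappa> = 2 * L + 1"
  have \<kappa>: "\<kappa> > 0" using L by (simp add: \<kappa>_def)
  define h where "h u s = G (y0 + exp (\<kappa> * s) *\<^sub>R apply_bcontfun u s)" for u :: "real \<Rightarrow>\<^sub>C 'a" and s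
  \<comment> \<open>extended by a constant to negative times, as the function space has all of \<open>\<real>\<close> as domain\<close>
  define \<Phi> where "\<Phi> u t = exp (- \<kappa> * max 0 t) *\<^sub>R integral {0..max 0 t} (h u)" for u t
  have G: "norm (G x - G y) \<le> L * norm (x - y)" for x y
    using lipschitz_onD[OF lip, of x y] by (simp add: dist_norm)
  have ch: "continuous_on S (h u)" for S u
    unfolding h_def
    by (intro continuous_on_compose2[OF lipschitz_on_continuous_on[OF lip]] continuous_intros) auto
  have I: "((\<lambda>t. integral {0..t} (h u)) has_vector_derivative h u t) (at t within {0..})"
    if "0 \<le> t" for u t
    by (rule integral_has_vector_derivative_atLeast[OF ch that])
  have cI: "continuous_on {0..} (\<lambda>t. integral {0..t} (h u))" for u
    using has_vector_derivative_continuous[OF I] by (auto simp: continuous_on_eq_continuous_within)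
  have "continuous_on UNIV (\<Phi> u)" for u
    unfolding \<Phi>_def
    by (intro continuous_intros continuous_on_compose2[OF cI]) auto
  moreover have "norm (\<Phi> u t) \<le> (norm (G y0) + L * norm u) / \<kappa>" for u t
    unfolding \<Phi>_def
  proof (rule norm_weighted_integral_le)
    fix s :: real assume s: "0 \<le> s"
    have "norm (h u s) \<le> norm (G y0) + norm (h u s - G y0)"
      using norm_triangle_ineq[of "G y0" "h u s - G y0"] by simp
    also have "norm (h u s - G y0) \<le> L * (exp (\<kappa> * s) * norm (apply_bcontfun u s))"
      using G[of "y0 + exp (\<kappa> * s) *\<^sub>R apply_bcontfun u s" y0] by (simp add: h_def)
    also have "\<dots> \<le> L * (exp (\<kappa> * s) * norm u)"
      using L norm_bounded[of u s] by (intro mult_left_mono) auto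
    also have "norm (G y0) + \<dots> \<le> norm (G y0) * exp (\<kappa> * s) + \<dots>"
      using s \<kappa> mult_left_mono[of 1 "exp (\<kappa> * s)" "norm (G y0)"] by simp
    finally show "norm (h u s) \<le> (norm (G y0) + L * norm u) * exp (\<kappa> * s)"
      by (simp add: algebra_simps)
  qed (use \<kappa> L ch in auto)
  ultimately have \<Phi>: "\<Phi> u \<in> bcontfun" for u
    by (intro bcontfun_normI)
  have "dist (Bcontfun (\<Phi> u)) (Bcontfun (\<Phi> v)) \<le> L / \<kappa> * dist u v" for u v
  proof (rule dist_bound)
    fix t
    have int: "h w integrable_on {0..max 0 t}" for w
      by (rule integrable_continuous_real[OF ch])
    have "\<Phi> u t - \<Phi> v t = exp (- \<kappa> * max 0 t) *\<^sub>R integral {0..max 0 t} (\<lambda>s. h u s - h v s)"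
      by (simp add: \<Phi>_def integral_diff[OF int int] scaleR_diff_right)
    also have "norm \<dots> \<le> (L * dist u v) / \<kappa>"
    proof (rule norm_weighted_integral_le)
      fix s :: real
      have "norm (h u s - h v s) \<le> L * (exp (\<kappa> * s) * norm (apply_bcontfun u s - apply_bcontfun v s))"
        using G[of "y0 + exp (\<kappa> * s) *\<^sub>R apply_bcontfun u s" "y0 + exp (\<kappa> * s) *\<^sub>R apply_bcontfun v s"]
        by (simp add: h_def scaleR_diff_right[symmetric])
      also have "\<dots> \<le> L * (exp (\<kappa> * s) * dist u v)"
        using L dist_bounded[of u s v] by (intro mult_left_mono) (auto simp: dist_norm)
      finally show "norm (h u s - h v s) \<le> L * dist u v * exp (\<kappa> * s)" by (simp add: mult_ac)
    qed (use \<kappa> L ch in \<open>auto intro: continuous_on_diff\<close>)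
    finally show "dist (apply_bcontfun (Bcontfun (\<Phi> u)) t) (apply_bcontfun (Bcontfun (\<Phi> v)) t)
        \<le> L / \<kappa> * dist u v"
      by (simp add: Bcontfun_inverse[OF \<Phi>] dist_norm)
  qed
  then obtain u where "Bcontfun (\<Phi> u) = u"
    using banach_fix_type[of "L / \<kappa>" "\<lambda>u. Bcontfun (\<Phi> u)"] L \<kappa> by (auto simp: \<kappa>_def)
  then have u: "apply_bcontfun u t = \<Phi> u t" for t
    using Bcontfun_inverse[OF \<Phi>, of u] by metis
  define y where "y t = y0 + integral {0..t} (h u)" for t
  have hy: "h u t = G (y t)" if "0 \<le> t" for t
  proof -
    have "exp (\<kappa> * t) *\<^sub>R apply_bcontfun u t = integral {0..t} (h u)"
      unfolding u \<Phi>_def using that by (simp add: exp_minus)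
    then show ?thesis by (simp add: h_def y_def)
  qed
  have "solution G y"
    unfolding solution_def y_def[abs_def]
    using I hy by (auto intro!: derivative_eq_intros simp: y_def)
  then show ?thesis by (intro exI[of _ y]) (simp add: y_def)
qed

lemma derivative_le_imp_increment_le:
  fixes u :: "real \<Rightarrow> real"
  assumes "\<And>\<tau>. 0 \<le> \<tau> \<Longrightarrow> (u has_real_derivative u' \<tau>) (at \<tau> within {0..})"
    and "0 \<le> s" "s \<le> t" "\<And>\<tau>. s < \<tau> \<Longrightarrow> \<tau> < t \<Longrightarrow> u' \<tau> \<le> c"
  shows "u t - u s \<le> c * (t - s)"
proof (cases "s = t")
  case False
  then have "s < t" using assms(3) by simp
  have "(u has_derivative (\<lambda>d. u' \<tau> * d)) (at \<tau> within {s..t})" if "s \<le> \<tau>" for \<tau>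
  proof -
    have "(u has_real_derivative u' \<tau>) (at \<tau> within {s..t})"
      by (rule has_field_derivative_subset[OF assms(1)]) (use that assms(2) in auto)
    then show ?thesis by (simp add: has_field_derivative_def)
  qed
  from mvt_simple[OF \<open>s < t\<close> this] obtain \<tau> where \<tau>: "\<tau> \<in> {s<..<t}" "u t - u s = u' \<tau> * (t - s)"
    by auto
  have "u' \<tau> * (t - s) \<le> c * (t - s)"
    using \<tau> assms(4)[of \<tau>] \<open>s < t\<close> by (intro mult_right_mono) auto
  then show ?thesis using \<tau>(2) by simp
qed simp

lemma has_vector_derivative_imp_has_lie_derivative:
  fixes V :: "'a::real_normed_vector \<Rightarrow> real"
  assumes "V differentiable (at (z t))" "(z has_vector_derivative v) (at t within S)"
  shows "((\<lambda>t. V (z t)) has_real_derivative frechet_derivative V (at (z t)) v) (at t within S)"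
proof -
  have V: "(V has_derivative frechet_derivative V (at (z t))) (at (z t))"
    using assms(1) by (simp add: frechet_derivative_works)
  interpret bounded_linear "frechet_derivative V (at (z t))"
    by (rule has_derivative_bounded_linear[OF V])
  have "(z has_derivative (\<lambda>s. s *\<^sub>R v)) (at t within S)"
    using assms(2) by (simp add: has_vector_derivative_def)
  from has_derivative_compose[OF this V] show ?thesis
    by (simp add: has_field_derivative_def scaleR mult_commute_abs)
qed

lemma solution_lie_derivative:
  fixes V :: "'a::real_normed_vector \<Rightarrow> real"
  assumes "solution F z" "\<And>p. V differentiable (at p)" "0 \<le> t"
  shows "((\<lambda>t. V (z t)) has_real_derivative lie_derivative V F (z t)) (at t within {0..})"
  unfolding lie_derivative_def
  by (rule has_vector_derivative_imp_has_lie_derivative) (use assms in \<open>auto simp: solution_def\<close>)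

lemma solution_continuous_on: "solution F z \<Longrightarrow> continuous_on {0..} z"
  unfolding solution_def continuous_on_eq_continuous_within
  using has_vector_derivative_continuous by fastforce

text \<open>Composing \<open>F\<close> with the projection onto a closed ball makes it globally Lipschitz without changing
  it on the ball.  If the ball contains the initial sublevel set of \<open>V\<close> in its interior, the solution of the
  modified equation cannot reach the boundary: up to the first time there, it solves the original
  equation, so \<open>V\<close> has not increased.\<close>
lemma lyapunov_solution_exists:
  fixes F :: "'a::euclidean_space \<Rightarrow> 'a"
  assumes lip: "local_lipschitz (UNIV :: real set) UNIV (\<lambda>_. F)"
    and V: "\<And>p. V differentiable (at p)" "\<And>p. lie_derivative V F p \<le> 0"
    and bnd: "bounded {p. V p \<le> V p0}"
  shows "\<exists>y. solution F y \<and> y 0 = p0"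
proof -
  obtain \<rho> where \<rho>: "\<rho> > 0" "{p. V p \<le> V p0} \<subseteq> ball 0 \<rho>"
    using bounded_subset_ballD[OF bnd, of 0] by blast
  let ?K = "cball 0 \<rho> :: 'a set"
  have "local_lipschitz {0 :: real} ?K (\<lambda>_. F)"
    by (rule local_lipschitz_subset[OF lip]) auto
  then obtain L where L: "L-lipschitz_on ?K F"
    using local_lipschitz_compact_implies_lipschitz[of "{0 :: real}" ?K "\<lambda>_. F"] by auto
  define G where "G p = F (closest_point ?K p)" for p
  have K: "closed ?K" "convex ?K" "?K \<noteq> {}" using \<rho>(1) by auto
  have "L-lipschitz_on UNIV G"
  proof (rule lipschitz_onI)
    fix x y :: 'a
    have "dist (G x) (G y) \<le> L * dist (closest_point ?K x) (closest_point ?K y)"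
      unfolding G_def by (intro lipschitz_onD[OF L] closest_point_in_set K)
    also have "\<dots> \<le> L * dist x y"
      by (intro mult_left_mono closest_point_lipschitz K lipschitz_on_nonneg[OF L])
    finally show "dist (G x) (G y) \<le> L * dist x y" .
  qed (rule lipschitz_on_nonneg[OF L])
  then obtain y where y: "solution G y" "y 0 = p0"
    using lipschitz_solution_exists by blast
  have GF: "G p = F p" if "p \<in> ?K" for p
    using that by (simp add: G_def closest_point_self)
  have "y t \<in> ball 0 \<rho>" if "t \<ge> 0" for t
  proof (rule ccontr)
    assume "y t \<notin> ball 0 \<rho>"
    define A where "A = {s \<in> {0..t}. \<rho> \<le> norm (y s)}"
    have "continuous_on {0..t} (\<lambda>s. norm (y s))"
      by (intro continuous_on_norm continuous_on_subset[OF solution_continuous_on[OF y(1)]]) auto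
    from continuous_closed_preimage[OF this closed_atLeastAtMost closed_atLeast, of \<rho>]
    have "closed A"
      by (simp add: A_def vimage_def Int_def)
    moreover have "bounded A" by (rule bounded_subset[of "{0..t}"]) (auto simp: A_def)
    ultimately have "compact A" by (simp add: compact_eq_bounded_closed)
    moreover have "t \<in> A" using that \<open>y t \<notin> ball 0 \<rho>\<close> by (simp add: A_def)
    ultimately obtain s where s: "s \<in> A" "\<And>s'. s' \<in> A \<Longrightarrow> s \<le> s'"
      using compact_attains_inf[of A] by blast
    have "V (y s) - V (y 0) \<le> 0 * (s - 0)"
    proof (rule derivative_le_imp_increment_le[OF solution_lie_derivative[OF y(1) V(1)]])
      fix \<tau> assume \<tau>: "0 < \<tau>" "\<tau> < s"
      then have "\<tau> \<notin> A" using s(2)[of \<tau>] by auto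
      then have "y \<tau> \<in> ?K" using \<tau> s(1) by (auto simp: A_def)
      then have "lie_derivative V G (y \<tau>) = lie_derivative V F (y \<tau>)"
        by (simp add: lie_derivative_def GF)
      then show "lie_derivative V G (y \<tau>) \<le> 0" using V(2) by simp
    qed (use s in \<open>auto simp: A_def\<close>)
    then have "y s \<in> ball 0 \<rho>" using \<rho>(2) y(2) by auto
    then show False using s(1) by (simp add: A_def)
  qed
  then have "solution F y"
    using y(1) GF unfolding solution_def by (metis ball_subset_cball subsetD)
  then show ?thesis using y(2) by blast
qed


section \<open>Stability from the two dissipation inequalities\<close>

lemma exp_decay_below:
  fixes v d c :: real
  assumes "d > 0" "v \<ge> 0" "c > 0"
  obtains \<tau> where "\<tau> > 0" "\<And>t. t \<ge> \<tau> \<Longrightarrow> exp (- c * t) * v \<le> d"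
proof
  show "(v / d + 1) / c > 0" using assms by (intro divide_pos_pos add_nonneg_pos) auto
  fix t assume "t \<ge> (v / d + 1) / c"
  then have "v / d + 1 \<le> c * t" using assms(3) by (simp add: field_simps)
  also have "\<dots> \<le> exp (c * t)" using exp_ge_add_one_self[of "c * t"] by linarith
  finally have "v \<le> d * exp (c * t)" using assms by (simp add: field_simps)
  then show "exp (- c * t) * v \<le> d" by (simp add: exp_minus field_simps)
qed

text \<open>The closed loop for one value of the parameter, reduced to what the stability analysis uses.
  \<open>Q\<close> is the part of the Lyapunov function that measures the estimation error, and
  \<open>\<mu> = \<epsilon> (|\<theta>|\<^sup>2 - r)\<^sup>+\<close>.\<close>
locale dissipative_loop =
  fixes F :: "'a::euclidean_space \<times> 'b::euclidean_space \<Rightarrow> 'a \<times> 'b"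
    and T :: "'a \<times> 'b \<Rightarrow> 'a" and Q :: "'a \<times> 'b \<Rightarrow> real"
    and \<theta> :: 'b and \<alpha> \<omega> \<mu> q :: real
  assumes smooth_F: "smooth F" and F_zero: "\<And>h. F (0, h) = 0"
    and T: "smooth_diffeo_family T"
    and Q: "\<And>p. Q differentiable (at p)" "q > 0" "\<And>p. q * (norm (snd p - \<theta>))\<^sup>2 \<le> Q p"
      "Q (0, \<theta>) = 0"
    and \<alpha>: "\<alpha> > 0" and \<omega>: "\<omega> > 0" and \<mu>: "\<mu> \<ge> 0"
    and lie_V: "\<And>p. lie_derivative (\<lambda>p. 1/2 * (norm (T p))\<^sup>2 + Q p) F p \<le> - \<alpha> * (norm (T p))\<^sup>2"
    and lie_T: "\<And>p. lie_derivative (\<lambda>p. 1/2 * (norm (T p))\<^sup>2) F p \<le> - \<omega> * (norm (T p))\<^sup>2 + \<mu>"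
begin

definition V where "V p = 1/2 * (norm (T p))\<^sup>2 + Q p"

lemma T_zero: "T (0, h) = 0"
  using T by (simp add: smooth_diffeo_family_def)

lemma T_eq_zero: "T (x, h) = 0 \<Longrightarrow> x = 0"
  using T unfolding smooth_diffeo_family_def by metis

lemma T_differentiable: "(\<lambda>p. 1/2 * (norm (T p))\<^sup>2) differentiable (at p)"
proof -
  have "(T has_derivative frechet_derivative T (at p)) (at p)"
    using T by (intro smooth_has_derivative) (simp add: smooth_diffeo_family_def)
  then have "((\<lambda>p. 1/2 * (T p \<bullet> T p)) has_derivative
      (\<lambda>v. 1/2 * (T p \<bullet> frechet_derivative T (at p) v + frechet_derivative T (at p) v \<bullet> T p))) (at p)"
    by (intro derivative_intros)
  then show ?thesis unfolding power2_norm_eq_inner differentiable_def by blast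
qed

lemma V_differentiable: "V differentiable (at p)"
  unfolding V_def[abs_def] by (intro differentiable_add T_differentiable Q)

lemma V_continuous: "continuous_on S V"
  using V_differentiable differentiable_at_imp_differentiable_on differentiable_imp_continuous_on
  by blast

lemma Q_nonneg: "Q p \<ge> 0"
  using Q(2) Q(3)[of p] by (meson less_imp_le mult_nonneg_nonneg order_trans zero_le_power2)

lemma V_nonneg: "V p \<ge> 0"
  using Q_nonneg by (simp add: V_def)

lemma V_zero: "V (0, \<theta>) = 0"
  by (simp add: V_def T_zero Q)

lemma V_eq_zero: "V p = 0 \<Longrightarrow> p = (0, \<theta>)"
proof -
  assume "V p = 0"
  then have "norm (T p) = 0" "Q p = 0"
    using Q_nonneg[of p] zero_le_power2[of "norm (T p)"] unfolding V_def by (simp_all add: add_nonneg_eq_0_iff)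
  moreover have "norm (snd p - \<theta>) = 0"
    using Q(2) Q(3)[of p] \<open>Q p = 0\<close> by (simp add: mult_le_0_iff)
  ultimately show ?thesis using T_eq_zero[of "fst p" "snd p"] by (cases p) simp
qed

lemma norm_T_le_V: "(norm (T p))\<^sup>2 \<le> 2 * V p"
  using Q_nonneg[of p] by (simp add: V_def)

lemma lie_V_nonpos: "lie_derivative V F p \<le> - \<alpha> * (norm (T p))\<^sup>2" "lie_derivative V F p \<le> 0"
proof -
  show 1: "lie_derivative V F p \<le> - \<alpha> * (norm (T p))\<^sup>2"
    using lie_V[of p] by (simp add: V_def[abs_def])
  have "0 \<le> \<alpha> * (norm (T p))\<^sup>2" using \<alpha> by simp
  then show "lie_derivative V F p \<le> 0" using 1 by simp
qed

text \<open>Bounds on \<open>V\<close> confine \<open>T\<close> and the estimate to balls; the state is then recovered continuously as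
  \<open>T\<^sup>-\<^sup>1\<close> of these data.\<close>
lemma compact_sublevel: "compact {p. V p \<le> v}"
proof -
  obtain S where S: "smooth S" "\<And>x h. S (T (x, h), h) = x"
    using T unfolding smooth_diffeo_family_def by metis
  define K where "K = cball (0 :: 'a) (sqrt (2 * v)) \<times> cball \<theta> (sqrt (v / q))"
  have "compact ((\<lambda>p. (S p, snd p)) ` K)"
    unfolding K_def
    by (intro compact_continuous_image continuous_intros smooth_continuous[OF S(1)] compact_Times) auto
  moreover have "{p. V p \<le> v} \<subseteq> (\<lambda>p. (S p, snd p)) ` K"
  proof
    fix p assume "p \<in> {p. V p \<le> v}"
    then have "V p \<le> v" by simp
    have "norm (T p) \<le> sqrt (2 * v)"
      using norm_T_le_V[of p] \<open>V p \<le> v\<close> by (intro real_le_rsqrt) simp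
    moreover have "norm (snd p - \<theta>) \<le> sqrt (v / q)"
    proof (rule real_le_rsqrt)
      have "q * (norm (snd p - \<theta>))\<^sup>2 \<le> v"
        using Q(3)[of p] \<open>V p \<le> v\<close> zero_le_power2[of "norm (T p)"] unfolding V_def by linarith
      then show "(norm (snd p - \<theta>))\<^sup>2 \<le> v / q" using Q(2) by (simp add: field_simps)
    qed
    ultimately have "(T p, snd p) \<in> K" by (simp add: K_def dist_norm norm_minus_commute)
    moreover have "p = (S (T p, snd p), snd p)" using S(2)[of "fst p" "snd p"] by simp
    ultimately show "p \<in> (\<lambda>p. (S p, snd p)) ` K" by force
  qed
  ultimately have "bounded {p. V p \<le> v}" using bounded_subset compact_imp_bounded by blast
  moreover have "closed {p. V p \<le> v}"
    by (intro closed_Collect_le V_continuous continuous_intros)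
  ultimately show ?thesis by (simp add: compact_eq_bounded_closed)
qed

text \<open>Where \<open>B\<close> is at least \<open>e\<close>, the function \<open>A\<close> is positive, and it attains its minimum on the
  intersection of this set with a compact sublevel set.\<close>
lemma small_on_sublevel:
  fixes A B :: "'a \<times> 'b \<Rightarrow> real"
  assumes "continuous_on UNIV A" "continuous_on UNIV B" "\<And>p. A p \<le> 0 \<Longrightarrow> B p \<le> 0" "e > 0"
  obtains d where "d > 0" "\<And>p. V p \<le> v \<Longrightarrow> A p < d \<Longrightarrow> B p < e"
proof -
  define K where "K = {p. V p \<le> v} \<inter> {p. e \<le> B p}"
  have "compact K"
    unfolding K_def
    by (intro compact_Int_closed compact_sublevel closed_Collect_le assms continuous_intros)
  show ?thesis
  proof (cases "K = {}")
    case True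
    show ?thesis by (rule that[of 1]) (use True in \<open>auto simp: K_def not_le[symmetric]\<close>)
  next
    case False
    then obtain p where p: "p \<in> K" "\<And>p'. p' \<in> K \<Longrightarrow> A p \<le> A p'"
      using continuous_attains_inf[OF \<open>compact K\<close> False continuous_on_subset[OF assms(1)]] by blast
    show ?thesis
    proof (rule that)
      show "A p > 0" using p(1) assms(3)[of p] assms(4) by (force simp: K_def)
      show "B p' < e" if "V p' \<le> v" "A p' < A p" for p'
        using p(2)[of p'] that by (force simp: K_def)
    qed
  qed
qed

lemma V_small:
  assumes "e > 0"
  obtains d where "d > 0" "\<And>p. V p < d \<Longrightarrow> dist p (0, \<theta>) < e"
proof -
  obtain d where d: "d > 0" "\<And>p. V p \<le> 1 \<Longrightarrow> V p < d \<Longrightarrow> dist p (0, \<theta>) < e"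
  proof (rule small_on_sublevel[of V "\<lambda>p. dist p (0, \<theta>)" e 1])
    show "dist p (0, \<theta>) \<le> 0" if "V p \<le> 0" for p
      using V_eq_zero[of p] V_nonneg[of p] that by auto
  qed (auto intro!: V_continuous continuous_intros assms)
  show ?thesis by (rule that[of "min d 1"]) (use d in auto)
qed

lemma T_small:
  assumes "e > 0"
  obtains d where "d > 0" "\<And>p. V p \<le> v \<Longrightarrow> norm (T p) < d \<Longrightarrow> norm (fst p) < e"
proof (rule small_on_sublevel[of "\<lambda>p. norm (T p)" "\<lambda>p. norm (fst p)" e v])
  show "norm (fst p) \<le> 0" if "norm (T p) \<le> 0" for p
    using T_eq_zero[of "fst p" "snd p"] that by simp
  show "continuous_on UNIV (\<lambda>p. norm (T p))"
    using T by (intro continuous_on_norm smooth_continuous) (simp add: smooth_diffeo_family_def)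
qed (use that assms in \<open>auto intro!: continuous_intros\<close>)

lemma V_bounded_on_ball: "\<exists>v\<ge>0. \<forall>p. dist p (0, \<theta>) < R \<longrightarrow> V p \<le> v"
proof -
  have "compact (V ` cball (0, \<theta>) R)"
    by (intro compact_continuous_image V_continuous compact_cball)
  from compact_imp_bounded[OF this, unfolded bounded_iff]
  obtain v where v: "\<forall>y\<in>V ` cball (0, \<theta>) R. norm y \<le> v" ..
  have "V p \<le> max v 0" if "dist p (0, \<theta>) < R" for p
    using bspec[OF v imageI, of p] that by (simp add: dist_commute)
  then have "\<forall>p. dist p (0, \<theta>) < R \<longrightarrow> V p \<le> max v 0" by blast
  then show ?thesis by (intro exI[of _ "max v 0"]) auto
qed

lemma V_small_near:
  assumes "d > 0"
  obtains \<delta> where "\<delta> > 0" "\<And>p. dist p (0, \<theta>) < \<delta> \<Longrightarrow> V p < d"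
proof -
  have "isCont V (0, \<theta>)"
    using V_continuous[of UNIV] continuous_on_eq_continuous_at by blast
  then show ?thesis
    using that assms unfolding continuous_at_eps_delta V_zero
    by (metis UNIV_I abs_ge_self diff_zero dist_real_def order_le_less_trans)
qed

lemma V_nonincreasing:
  assumes "solution F z" "0 \<le> s" "s \<le> t"
  shows "V (z t) \<le> V (z s)"
  using derivative_le_imp_increment_le[OF solution_lie_derivative[OF assms(1) V_differentiable], of s t 0]
    assms lie_V_nonpos(2) by simp

lemma solution_exists: "\<exists>z. solution F z \<and> z 0 = p"
  by (rule lyapunov_solution_exists[OF smooth_local_lipschitz[OF smooth_F] V_differentiable
        lie_V_nonpos(2) compact_imp_bounded[OF compact_sublevel]])

lemma solution_bounded: "solution F z \<Longrightarrow> bounded (z ` {0..})"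
  by (rule bounded_subset[OF compact_imp_bounded[OF compact_sublevel[of "V (z 0)"]]])
    (auto intro: V_nonincreasing)

lemma solution_stays_near:
  assumes "e > 0"
  obtains \<delta> where "\<delta> > 0"
    "\<And>z t. solution F z \<Longrightarrow> dist (z 0) (0, \<theta>) < \<delta> \<Longrightarrow> t \<ge> 0 \<Longrightarrow> dist (z t) (0, \<theta>) < e"
proof -
  obtain d where d: "d > 0" "\<And>p. V p < d \<Longrightarrow> dist p (0, \<theta>) < e"
    using V_small[OF assms] by blast
  obtain \<delta> where \<delta>: "\<delta> > 0" "\<And>p. dist p (0, \<theta>) < \<delta> \<Longrightarrow> V p < d" using V_small_near[OF d(1)] by blast
  show ?thesis
  proof (rule that[OF \<delta>(1)])
    show "dist (z t) (0, \<theta>) < e" if "solution F z" "dist (z 0) (0, \<theta>) < \<delta>" "t \<ge> 0" for z t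
      using V_nonincreasing[OF that(1), of 0 t] \<delta>(2)[OF that(2)] that(3) by (intro d(2)) simp
  qed
qed

lemma lyapunov_stable_state: "lyapunov_stable F (0, \<theta>)"
  unfolding lyapunov_stable_def
proof (intro conjI allI impI)
  show "(0, \<theta>) \<in> equilibria F" by (simp add: equilibria_def F_zero)
  fix e :: real assume "e > 0"
  then obtain \<delta> where "\<delta> > 0"
    "\<And>z t. solution F z \<Longrightarrow> dist (z 0) (0, \<theta>) < \<delta> \<Longrightarrow> t \<ge> 0 \<Longrightarrow> dist (z t) (0, \<theta>) < e"
    using solution_stays_near by blast
  then show "\<exists>\<delta>>0. \<forall>\<xi>\<^sub>0\<in>ball (0, \<theta>) \<delta>. (\<exists>\<xi>. solution F \<xi> \<and> \<xi> 0 = \<xi>\<^sub>0) \<and>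
      (\<forall>\<xi>. solution F \<xi> \<and> \<xi> 0 = \<xi>\<^sub>0 \<longrightarrow> (\<forall>t\<ge>0. dist (\<xi> t) (0, \<theta>) < e))"
    using solution_exists by (intro exI[of _ \<delta>]) (simp add: dist_commute)
qed

lemma equilibria_F: "equilibria F = {(0, h) | h. True}"
proof -
  have "p \<in> {(0, h) | h. True}" if "F p = 0" for p
  proof -
    have "lie_derivative V F p = 0"
      unfolding lie_derivative_def that
      by (rule linear_0[OF has_derivative_linear[OF frechet_derivative_works[THEN iffD1, OF V_differentiable]]])
    then have "\<alpha> * (norm (T p))\<^sup>2 \<le> 0" using lie_V_nonpos(1)[of p] by simp
    then have "T (fst p, snd p) = 0" using \<alpha> by (simp add: mult_le_0_iff)
    then have "fst p = 0" by (rule T_eq_zero)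
    then show ?thesis by (cases p) auto
  qed
  then show ?thesis by (auto simp: equilibria_def F_zero)
qed

text \<open>The second inequality is a linear differential inequality for \<open>|T|\<^sup>2 - \<mu> / \<omega>\<close> with rate \<open>2 \<omega>\<close>;
  multiply by \<open>exp (2 \<omega> t)\<close>.\<close>
lemma T_decay:
  assumes "solution F z" "0 \<le> t"
  shows "(norm (T (z t)))\<^sup>2 - \<mu> / \<omega> \<le> exp (- (2 * \<omega>) * t) * ((norm (T (z 0)))\<^sup>2 - \<mu> / \<omega>)"
proof -
  define G where "G p = 1/2 * (norm (T p))\<^sup>2" for p
  define m where "m t = exp (2 * \<omega> * t) * (G (z t) - \<mu> / (2 * \<omega>))" for t
  have G: "((\<lambda>t. G (z t)) has_real_derivative lie_derivative G F (z t)) (at t within {0..})" if "0 \<le> t" for t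
    using solution_lie_derivative[OF assms(1) T_differentiable that] by (simp add: G_def[abs_def])
  have "(m has_real_derivative exp (2 * \<omega> * t) * (2 * \<omega>) * (G (z t) - \<mu> / (2 * \<omega>))
      + exp (2 * \<omega> * t) * lie_derivative G F (z t)) (at t within {0..})" if "0 \<le> t" for t
    unfolding m_def[abs_def] using G[OF that]
    by (auto intro!: derivative_eq_intros simp: algebra_simps)
  then have "m t - m 0 \<le> 0 * (t - 0)"
  proof (rule derivative_le_imp_increment_le)
    fix \<tau>
    have "lie_derivative G F (z \<tau>) + 2 * \<omega> * (G (z \<tau>) - \<mu> / (2 * \<omega>)) \<le> 0"
    proof -
      have "2 * \<omega> * (G (z \<tau>) - \<mu> / (2 * \<omega>)) = \<omega> * (norm (T (z \<tau>)))\<^sup>2 - \<mu>"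
        using \<omega> by (simp add: G_def right_diff_distrib)
      then show ?thesis using lie_T[of "z \<tau>"] by (simp add: G_def[abs_def])
    qed
    then have "exp (2 * \<omega> * \<tau>) * (lie_derivative G F (z \<tau>) + 2 * \<omega> * (G (z \<tau>) - \<mu> / (2 * \<omega>))) \<le> 0"
      by (simp add: mult_le_0_iff)
    then show "exp (2 * \<omega> * \<tau>) * (2 * \<omega>) * (G (z \<tau>) - \<mu> / (2 * \<omega>))
      + exp (2 * \<omega> * \<tau>) * lie_derivative G F (z \<tau>) \<le> 0"
      by (simp only: distrib_left mult.assoc add.commute)
  qed (use assms(2) in auto)
  then have "exp (2 * \<omega> * t) * (G (z t) - \<mu> / (2 * \<omega>)) \<le> G (z 0) - \<mu> / (2 * \<omega>)"
    by (simp add: m_def)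
  then have "exp (- (2 * \<omega>) * t) * (exp (2 * \<omega> * t) * (G (z t) - \<mu> / (2 * \<omega>)))
      \<le> exp (- (2 * \<omega>) * t) * (G (z 0) - \<mu> / (2 * \<omega>))"
    by (rule mult_left_mono) simp
  then have "G (z t) - \<mu> / (2 * \<omega>) \<le> exp (- (2 * \<omega>) * t) * (G (z 0) - \<mu> / (2 * \<omega>))"
    by (simp add: mult.assoc[symmetric] exp_add[symmetric])
  then have "2 * (G (z t) - \<mu> / (2 * \<omega>)) \<le> 2 * (exp (- (2 * \<omega>) * t) * (G (z 0) - \<mu> / (2 * \<omega>)))"
    by simp
  moreover have "2 * (G p - \<mu> / (2 * \<omega>)) = (norm (T p))\<^sup>2 - \<mu> / \<omega>" for p
    using \<omega> by (simp add: G_def field_simps)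
  ultimately show ?thesis by (metis mult.left_commute)
qed

text \<open>A one-sided form of Barbalat's lemma.  Because \<open>|T|\<^sup>2/2\<close> grows at most with speed \<open>\<mu>\<close>, a value above
  \<open>e\<close> at time \<open>t\<close> was preceded by values above \<open>e/2\<close> during a time \<open>\<delta>\<close> independent of \<open>t\<close>, in which
  \<open>V\<close> lost at least \<open>\<alpha> e \<delta>\<close>.  This is impossible once \<open>V\<close> is that close to its infimum.\<close>
lemma T_tendsto_zero:
  assumes z: "solution F z" and "e > 0"
  shows "\<exists>\<tau>. \<forall>t\<ge>\<tau>. 1/2 * (norm (T (z t)))\<^sup>2 < e"
proof -
  define G where "G p = 1/2 * (norm (T p))\<^sup>2" for p
  \<comment> \<open>\<open>\<mu> + 1\<close> instead of \<open>\<mu>\<close> keeps the denominator positive when \<open>\<mu> = 0\<close>\<close>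
  define \<delta> where "\<delta> = e / (2 * (\<mu> + 1))"
  have \<delta>: "\<delta> > 0" "\<mu> * \<delta> \<le> e / 2" using \<mu> \<open>e > 0\<close> by (auto simp: \<delta>_def field_simps)
  define v where "v = Inf ((\<lambda>t. V (z t)) ` {0..})"
  have bdd: "bdd_below ((\<lambda>t. V (z t)) ` {0..})" by (rule bdd_belowI2[OF V_nonneg])
  have "v < v + \<alpha> * e * \<delta>" using \<alpha> \<open>e > 0\<close> \<delta> by simp
  then obtain \<tau> where \<tau>: "\<tau> \<ge> 0" "V (z \<tau>) < v + \<alpha> * e * \<delta>"
    using cInf_lessD[of "(\<lambda>t. V (z t)) ` {0..}"] unfolding v_def by force
  have "G (z t) < e" if "t \<ge> \<tau> + \<delta>" for t
  proof (rule ccontr)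
    assume "\<not> G (z t) < e"
    have G: "((\<lambda>t. G (z t)) has_real_derivative lie_derivative G F (z s)) (at s within {0..})" if "0 \<le> s" for s
      using solution_lie_derivative[OF z T_differentiable that] by (simp add: G_def[abs_def])
    have "G (z s) \<ge> e / 2" if s: "t - \<delta> < s" "s < t" for s
    proof -
      have "G (z t) - G (z s) \<le> \<mu> * (t - s)"
      proof (rule derivative_le_imp_increment_le[OF G])
        fix \<sigma>
        have "0 \<le> \<omega> * (norm (T (z \<sigma>)))\<^sup>2" using \<omega> by simp
        then show "lie_derivative G F (z \<sigma>) \<le> \<mu>"
          using lie_T[of "z \<sigma>"] unfolding G_def[abs_def] by linarith
      qed (use s \<open>t \<ge> \<tau> + \<delta>\<close> \<tau> in auto)
      also have "\<dots> \<le> \<mu> * \<delta>" using \<mu> s by (intro mult_left_mono) auto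
      finally show ?thesis using \<delta>(2) \<open>\<not> G (z t) < e\<close> by simp
    qed
    then have "lie_derivative V F (z s) \<le> - (\<alpha> * e)" if "t - \<delta> < s" "s < t" for s
    proof -
      have "\<alpha> * e \<le> \<alpha> * (norm (T (z s)))\<^sup>2"
        using \<open>\<And>s. _ \<Longrightarrow> _ \<Longrightarrow> e / 2 \<le> G (z s)\<close>[OF that] \<alpha> by (intro mult_left_mono) (auto simp: G_def)
      then show ?thesis using lie_V_nonpos(1)[of "z s"] by simp
    qed
    then have "V (z t) - V (z (t - \<delta>)) \<le> - (\<alpha> * e) * (t - (t - \<delta>))"
      using that \<tau> \<delta>
      by (intro derivative_le_imp_increment_le[OF solution_lie_derivative[OF z V_differentiable]]) auto
    moreover have "V (z (t - \<delta>)) \<le> V (z \<tau>)" using that \<tau> by (intro V_nonincreasing[OF z]) auto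
    moreover have "v \<le> V (z t)" unfolding v_def using that \<tau> \<delta> by (intro cInf_lower[OF _ bdd]) auto
    ultimately show False using \<tau>(2) by simp
  qed
  then show ?thesis unfolding G_def by blast
qed

lemma state_tendsto_zero:
  assumes z: "solution F z"
  shows "((\<lambda>t. fst (z t)) \<longlongrightarrow> 0) at_top"
proof (rule tendstoI)
  fix e :: real assume "e > 0"
  then obtain d where d: "d > 0" "\<And>p. V p \<le> V (z 0) \<Longrightarrow> norm (T p) < d \<Longrightarrow> norm (fst p) < e"
    by (rule T_small) blast
  obtain \<tau> where \<tau>: "\<And>t. t \<ge> \<tau> \<Longrightarrow> 1/2 * (norm (T (z t)))\<^sup>2 < d\<^sup>2 / 2"
    using T_tendsto_zero[OF z, of "d\<^sup>2 / 2"] d(1) by auto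
  have "dist (fst (z t)) 0 < e" if "t \<ge> max \<tau> 0" for t
  proof -
    have "norm (T (z t)) < d"
      using \<tau>[of t] that d(1) by (intro power2_less_imp_less[of _ d]) auto
    then show ?thesis using d(2)[of "z t"] V_nonincreasing[OF z, of 0 t] that by simp
  qed
  then show "\<forall>\<^sub>F t in at_top. dist (fst (z t)) 0 < e"
    unfolding eventually_at_top_linorder by blast
qed

definition F_shift where "F_shift \<xi> = F (\<xi> + (0, \<theta>))"

lemma solution_shift:
  assumes "solution F_shift \<xi>"
  shows "solution F (\<lambda>t. \<xi> t + (0, \<theta>))"
  using assms unfolding solution_def F_shift_def
  by (auto intro!: has_vector_derivative_add_const[THEN iffD2])

lemma dist_shift: "dist (\<xi> + (0, \<theta>)) (0, \<theta>) = norm \<xi>" for \<xi> :: "'a \<times> 'b"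
  by (simp add: dist_norm)

lemma output_system_shift:
  assumes "finite I" "\<And>i. i \<in> I \<Longrightarrow> continuous_on UNIV (\<lambda>\<xi>. H \<xi> i)" "\<And>i. i \<in> I \<Longrightarrow> H 0 i = 0"
  shows "output_system F_shift H I"
  unfolding output_system_def
proof (intro conjI ballI)
  have "smooth (\<lambda>\<xi>. F (\<xi> + (0, \<theta>)))"
    by (intro smooth_compose[OF smooth_F] smooth_add smooth_const smooth_bounded_linear
        bounded_linear_ident)
  then have "smooth F_shift" by (simp add: F_shift_def[abs_def])
  then show "local_lipschitz (UNIV :: real set) UNIV (\<lambda>_. F_shift)" by (rule smooth_local_lipschitz)
  show "F_shift 0 = 0" using F_zero[of \<theta>] by (simp add: F_shift_def)
  show "forward_complete F_shift"
    unfolding forward_complete_def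
  proof
    fix \<xi>0
    obtain z where z: "solution F z" "z 0 = \<xi>0 + (0, \<theta>)" using solution_exists by blast
    have "solution F_shift (\<lambda>t. z t - (0, \<theta>))"
      using z(1) unfolding solution_def F_shift_def
      by (auto intro!: has_vector_derivative_diff_const[THEN iffD2])
    then show "\<exists>\<xi>. solution F_shift \<xi> \<and> \<xi> 0 = \<xi>0"
      by (intro exI[of _ "\<lambda>t. z t - (0, \<theta>)"]) (simp add: z(2))
  qed
qed (use assms in auto)

lemma continuous_on_L2_set:
  assumes "finite I" "\<And>i. i \<in> I \<Longrightarrow> continuous_on UNIV (\<lambda>\<xi>. H \<xi> i)"
  shows "continuous_on UNIV (\<lambda>\<xi>. L2_set (H \<xi>) I)"
  unfolding L2_set_def using assms by (intro continuous_intros) auto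

text \<open>A continuous output is bounded on the compact invariant sublevel sets, and it is small near the
  equilibrium, where the full state stays.\<close>
lemma output_stable:
  assumes "output_system F_shift H I"
  shows "lagrange_output_stable F_shift H I" "lyapunov_output_stable F_shift H I"
proof -
  have cont: "continuous_on UNIV (\<lambda>\<xi>. L2_set (H \<xi>) I)"
    using assms by (intro continuous_on_L2_set) (auto simp: output_system_def)
  show "lagrange_output_stable F_shift H I"
    unfolding lagrange_output_stable_def
  proof (intro conjI assms allI impI)
    fix R :: real
    obtain v where v: "\<And>p. dist p (0, \<theta>) < R \<Longrightarrow> V p \<le> v" using V_bounded_on_ball by blast
    have "compact ((\<lambda>p. L2_set (H (p - (0, \<theta>))) I) ` {p. V p \<le> v})"
      by (intro compact_continuous_image compact_sublevel continuous_on_compose2[OF cont]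
          continuous_intros) auto
    then show "bounded {L2_set (H (\<xi> t)) I |\<xi> t. solution F_shift \<xi> \<and> \<xi> 0 \<in> ball 0 R \<and> 0 \<le> t}"
    proof (rule bounded_subset[OF compact_imp_bounded], safe)
      fix \<xi> t assume \<xi>: "solution F_shift \<xi>" "\<xi> 0 \<in> ball 0 R" "0 \<le> (t :: real)"
      have "V (\<xi> t + (0, \<theta>)) \<le> v"
        using V_nonincreasing[OF solution_shift[OF \<xi>(1)], of 0 t] v[of "\<xi> 0 + (0, \<theta>)"] \<xi>(2,3)
        by (simp add: dist_shift)
      then show "L2_set (H (\<xi> t)) I \<in> (\<lambda>p. L2_set (H (p - (0, \<theta>))) I) ` {p. V p \<le> v}"
        by (intro image_eqI[of _ _ "\<xi> t + (0, \<theta>)"]) auto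
    qed
  qed
  show "lyapunov_output_stable F_shift H I"
    unfolding lyapunov_output_stable_def
  proof (intro conjI assms allI impI)
    fix e :: real assume "e > 0"
    have "L2_set (H 0) I = 0"
      using assms by (simp add: output_system_def L2_set_def)
    moreover have "isCont (\<lambda>\<xi>. L2_set (H \<xi>) I) 0"
      using cont continuous_on_eq_continuous_at by blast
    ultimately obtain d where d: "d > 0" "\<And>\<xi>. dist \<xi> 0 < d \<Longrightarrow> dist (L2_set (H \<xi>) I) 0 < e"
      unfolding continuous_at_eps_delta using \<open>e > 0\<close> by metis
    obtain \<delta> where \<delta>: "\<delta> > 0"
      "\<And>z t. solution F z \<Longrightarrow> dist (z 0) (0, \<theta>) < \<delta> \<Longrightarrow> t \<ge> 0 \<Longrightarrow> dist (z t) (0, \<theta>) < d"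
      using solution_stays_near[OF d(1)] by blast
    have "L2_set (H (\<xi> t)) I \<le> e" if "solution F_shift \<xi>" "\<xi> 0 \<in> ball 0 \<delta>" "t \<ge> 0" for \<xi> t
      using \<delta>(2)[OF solution_shift[OF that(1)] _ that(3)] d(2)[of "\<xi> t"] that(2)
      by (simp add: dist_shift)
    then show "\<exists>\<eta>>0. \<forall>\<xi>. solution F_shift \<xi> \<and> \<xi> 0 \<in> ball 0 \<eta> \<longrightarrow> (\<forall>t\<ge>0. L2_set (H (\<xi> t)) I \<le> e)"
      using \<delta>(1) by blast
  qed
qed

lemma UGAOS_residual_output:
  assumes sys: "output_system F_shift H I" and b: "class_K_inf b"
    and H: "\<And>\<xi>. L2_set (H \<xi>) I \<le> b (max ((norm (T (\<xi> + (0, \<theta>))))\<^sup>2 - \<mu> / \<omega>) 0)"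
  shows "UGAOS F_shift H I"
  unfolding UGAOS_def
proof (intro conjI output_stable[OF sys] allI impI)
  fix e R :: real assume "e > 0" "R > 0"
  have "continuous (at 0 within {0..}) b"
    using b by (simp add: class_K_inf_def continuous_on_eq_continuous_within)
  then obtain d where d: "d > 0" "\<And>s. s \<ge> 0 \<Longrightarrow> dist s 0 < d \<Longrightarrow> dist (b s) (b 0) < e"
    using \<open>e > 0\<close> unfolding continuous_within_eps_delta by (metis atLeast_iff)
  obtain v where v: "v \<ge> 0" "\<And>p. dist p (0, \<theta>) < R \<Longrightarrow> V p \<le> v" using V_bounded_on_ball by blast
  obtain \<tau> where \<tau>: "\<tau> > 0" "\<And>t. t \<ge> \<tau> \<Longrightarrow> exp (- (2 * \<omega>) * t) * (2 * v) \<le> d / 2"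
    using exp_decay_below[of "d / 2" "2 * v" "2 * \<omega>"] d(1) v(1) \<omega> by auto
  have "L2_set (H (\<xi> t)) I \<le> e" if \<xi>: "solution F_shift \<xi>" "\<xi> 0 \<in> ball 0 R" "t \<ge> \<tau>" for \<xi> t
  proof -
    define s where "s = max ((norm (T (\<xi> t + (0, \<theta>))))\<^sup>2 - \<mu> / \<omega>) 0"
    have "(norm (T (\<xi> 0 + (0, \<theta>))))\<^sup>2 - \<mu> / \<omega> \<le> 2 * v"
      using norm_T_le_V[of "\<xi> 0 + (0, \<theta>)"] v(2)[of "\<xi> 0 + (0, \<theta>)"] \<xi>(2)
        divide_nonneg_pos[OF \<mu> \<omega>] by (simp add: dist_shift)
    then have "exp (- (2 * \<omega>) * t) * ((norm (T (\<xi> 0 + (0, \<theta>))))\<^sup>2 - \<mu> / \<omega>)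
        \<le> exp (- (2 * \<omega>) * t) * (2 * v)"
      by (rule mult_left_mono) simp
    moreover have "(norm (T (\<xi> t + (0, \<theta>))))\<^sup>2 - \<mu> / \<omega>
        \<le> exp (- (2 * \<omega>) * t) * ((norm (T (\<xi> 0 + (0, \<theta>))))\<^sup>2 - \<mu> / \<omega>)"
      using T_decay[OF solution_shift[OF \<xi>(1)], of t] \<tau>(1) \<xi>(3) by simp
    ultimately have "(norm (T (\<xi> t + (0, \<theta>))))\<^sup>2 - \<mu> / \<omega> \<le> d / 2"
      using \<tau>(2)[OF \<xi>(3)] by linarith
    then have "s \<le> d / 2" unfolding s_def using d(1) by (intro max.boundedI) auto
    moreover have "s \<ge> 0" by (simp add: s_def)
    ultimately have "dist (b s) (b 0) < e" using d(1) by (intro d(2)) auto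
    then show ?thesis using H[of "\<xi> t"] b by (simp add: s_def[symmetric] class_K_inf_def dist_real_def)
  qed
  then show "\<exists>\<tau>>0. \<forall>\<xi>. solution F_shift \<xi> \<and> \<xi> 0 \<in> ball 0 R \<longrightarrow> (\<forall>t\<ge>\<tau>. L2_set (H (\<xi> t)) I \<le> e)"
    using \<tau>(1) by blast
qed

text \<open>With \<open>\<mu> = 0\<close> the decay of \<open>T\<close> is exponential.  A bound of \<open>|x|\<close> by a function of \<open>|T|\<close> alone need not
  exist, but one exists on each sublevel set of \<open>V\<close>, and the initial ball determines the sublevel set.\<close>
lemma UGAOS_state:
  assumes sys: "output_system F_shift H I" and "\<mu> = 0"
    and H: "\<And>\<xi>. L2_set (H \<xi>) I = norm (fst \<xi>)"
  shows "UGAOS F_shift H I"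
  unfolding UGAOS_def
proof (intro conjI output_stable[OF sys] allI impI)
  fix e R :: real assume "e > 0" "R > 0"
  obtain v where v: "v \<ge> 0" "\<And>p. dist p (0, \<theta>) < R \<Longrightarrow> V p \<le> v" using V_bounded_on_ball by blast
  obtain d where d: "d > 0" "\<And>p. V p \<le> v \<Longrightarrow> norm (T p) < d \<Longrightarrow> norm (fst p) < e"
    using T_small[OF \<open>e > 0\<close>] by blast
  obtain \<tau> where \<tau>: "\<tau> > 0" "\<And>t. t \<ge> \<tau> \<Longrightarrow> exp (- (2 * \<omega>) * t) * (2 * v) \<le> d\<^sup>2 / 2"
    using exp_decay_below[of "d\<^sup>2 / 2" "2 * v" "2 * \<omega>"] d(1) v(1) \<omega> by auto
  have "L2_set (H (\<xi> t)) I \<le> e" if \<xi>: "solution F_shift \<xi>" "\<xi> 0 \<in> ball 0 R" "t \<ge> \<tau>" for \<xi> t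
  proof -
    have V: "V (\<xi> 0 + (0, \<theta>)) \<le> v" using v(2) \<xi>(2) by (simp add: dist_shift)
    then have "(norm (T (\<xi> 0 + (0, \<theta>))))\<^sup>2 \<le> 2 * v"
      using norm_T_le_V[of "\<xi> 0 + (0, \<theta>)"] by simp
    then have "exp (- (2 * \<omega>) * t) * (norm (T (\<xi> 0 + (0, \<theta>))))\<^sup>2 \<le> exp (- (2 * \<omega>) * t) * (2 * v)"
      by (rule mult_left_mono) simp
    moreover have "d\<^sup>2 / 2 < d\<^sup>2" using d(1) by simp
    moreover have "(norm (T (\<xi> t + (0, \<theta>))))\<^sup>2 \<le> exp (- (2 * \<omega>) * t) * (norm (T (\<xi> 0 + (0, \<theta>))))\<^sup>2"
      using T_decay[OF solution_shift[OF \<xi>(1)], of t] \<tau>(1) \<xi>(3) \<open>\<mu> = 0\<close> by simp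
    ultimately have "(norm (T (\<xi> t + (0, \<theta>))))\<^sup>2 < d\<^sup>2"
      using \<tau>(2)[OF \<xi>(3)] by linarith
    then have "norm (T (\<xi> t + (0, \<theta>))) < d" by (rule power2_less_imp_less) (use d in simp)
    moreover have "V (\<xi> t + (0, \<theta>)) \<le> v"
      using V V_nonincreasing[OF solution_shift[OF \<xi>(1)], of 0 t] \<xi>(3) \<tau>(1) by simp
    ultimately show ?thesis using d(2)[of "\<xi> t + (0, \<theta>)"] by (simp add: H)
  qed
  then show "\<exists>\<tau>>0. \<forall>\<xi>. solution F_shift \<xi> \<and> \<xi> 0 \<in> ball 0 R \<longrightarrow> (\<forall>t\<ge>\<tau>. L2_set (H (\<xi> t)) I \<le> e)"
    using \<tau>(1) by blast
qed

end


section \<open>Smooth functions of the first states and of the parameter estimate\<close>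

text \<open>Smooth functions of \<open>(x\<^sub>j)\<close>, \<open>j \<in> I\<close>, and of the estimate, kept as functions on the whole space so that
  all steps of the recursion share one type.\<close>
definition smooth_in ::
    "'n set \<Rightarrow> ('n::{finite,linorder} rvec \<times> 'p::finite rvec \<Rightarrow> real) \<Rightarrow> bool" where
  "smooth_in I F \<longleftrightarrow> smooth F \<and>
     (\<forall>p q. (\<forall>j\<in>I. fst p $ j = fst q $ j) \<and> snd p = snd q \<longrightarrow> F p = F q)"

lemma smooth_in_smooth: "smooth_in I F \<Longrightarrow> smooth F"
  by (simp add: smooth_in_def)

lemma smooth_in_cong:
  "smooth_in I F \<Longrightarrow> (\<And>j. j \<in> I \<Longrightarrow> fst p $ j = fst q $ j) \<Longrightarrow> snd p = snd q \<Longrightarrow> F p = F q"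
  unfolding smooth_in_def by blast

lemma smooth_in_mono: "smooth_in I F \<Longrightarrow> I \<subseteq> J \<Longrightarrow> smooth_in J F"
  unfolding smooth_in_def by blast

lemma smooth_in_const [intro]: "smooth_in I (\<lambda>p. c)"
  by (auto simp: smooth_in_def)

lemma smooth_in_add [intro]:
  assumes "smooth_in I F" "smooth_in I G" shows "smooth_in I (\<lambda>p. F p + G p)"
  using assms smooth_add[of F G] unfolding smooth_in_def by metis

lemma smooth_in_mult [intro]:
  assumes "smooth_in I F" "smooth_in I G" shows "smooth_in I (\<lambda>p. F p * G p)"
  using assms smooth_mult[of F G] unfolding smooth_in_def by metis

lemma smooth_in_diff [intro]:
  assumes "smooth_in I F" "smooth_in I G" shows "smooth_in I (\<lambda>p. F p - G p)"
  using smooth_in_add[OF assms(1) smooth_in_mult[OF smooth_in_const[of I "-1"] assms(2)]] by simp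

lemma smooth_in_inverse:
  assumes "smooth_in I F" "\<And>p. F p \<noteq> 0" shows "smooth_in I (\<lambda>p. inverse (F p))"
  using assms smooth_inverse[of F] unfolding smooth_in_def by metis

lemma smooth_in_sum [intro]:
  "(\<And>a. a \<in> A \<Longrightarrow> smooth_in I (F a)) \<Longrightarrow> smooth_in I (\<lambda>p. \<Sum>a\<in>A. F a p)"
  by (induction A rule: infinite_finite_induct) (auto simp: smooth_in_const smooth_in_add)

lemma smooth_in_state: "i \<in> I \<Longrightarrow> smooth_in I (\<lambda>p. fst p $ i)"
  unfolding smooth_in_def
  by (auto intro!: smooth_bounded_linear bounded_linear_compose[OF bounded_linear_vec_nth]
      bounded_linear_fst)

lemma smooth_in_estimate: "smooth_in I (\<lambda>p. snd p $ j)"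
  unfolding smooth_in_def
  by (auto intro!: smooth_bounded_linear bounded_linear_compose[OF bounded_linear_vec_nth]
      bounded_linear_snd)

lemma smooth_in_depends_upto:
  assumes "smooth F" "depends_upto i F" "{..i} \<subseteq> I"
  shows "smooth_in I (\<lambda>p. F (fst p))"
proof -
  have "smooth (\<lambda>p. F (fst p))"
    by (intro smooth_compose[OF assms(1)] smooth_bounded_linear bounded_linear_fst)
  moreover have "F (fst p) = F (fst q)" if "\<forall>j\<in>I. fst p $ j = fst q $ j" for p q
    using assms(2,3) that unfolding depends_upto_def by (metis atMost_iff subsetD)
  ultimately show ?thesis by (auto simp: smooth_in_def)
qed

lemma smooth_in_dird:
  assumes "smooth_in I F"
  shows "smooth_in I (dird F v)"
  unfolding smooth_in_def
proof (intro conjI allI impI)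
  show "smooth (dird F v)" by (intro smooth_dird smooth_in_smooth[OF assms])
  fix p q :: "'a rvec \<times> 'b rvec"
  assume pq: "(\<forall>j\<in>I. fst p $ j = fst q $ j) \<and> snd p = snd q"
  have "F (y + (q - p)) = F y" for y
    by (rule smooth_in_cong[OF assms]) (use pq in auto)
  moreover have "((\<lambda>y. F (y + (q - p))) has_derivative frechet_derivative F (at q)) (at p)"
  proof -
    have "((\<lambda>y. y + (q - p)) has_derivative (\<lambda>v. v)) (at p)"
      by (auto intro!: derivative_eq_intros)
    moreover have "(F has_derivative frechet_derivative F (at q)) (at (p + (q - p)))"
      using smooth_has_derivative[OF smooth_in_smooth[OF assms]] by simp
    ultimately show ?thesis by (rule has_derivative_compose)
  qed
  ultimately have "(F has_derivative frechet_derivative F (at q)) (at p)" by simp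
  then show "dird F v p = dird F v q"
    using frechet_derivative_at by metis
qed

lemma smooth_in_dird_zero:
  assumes "smooth_in I F" "l \<notin> I"
  shows "dird F (axis l 1, 0) p = 0"
proof -
  let ?v = "(axis l 1, 0)"
  have F: "(F has_derivative frechet_derivative F (at (p + 0 *\<^sub>R ?v))) (at (p + 0 *\<^sub>R ?v))"
    by (rule smooth_has_derivative[OF smooth_in_smooth[OF assms(1)]])
  have "((\<lambda>t. p + t *\<^sub>R ?v) has_derivative (\<lambda>t. t *\<^sub>R ?v)) (at 0)"
    by (auto intro!: derivative_eq_intros)
  from has_derivative_compose[OF this F]
  have "((\<lambda>t. F (p + t *\<^sub>R ?v)) has_derivative (\<lambda>t. frechet_derivative F (at p) (t *\<^sub>R ?v))) (at 0)"
    by (simp add: zero_prod_def[symmetric])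
  moreover have "F (p + t *\<^sub>R ?v) = F p" for t
    by (rule smooth_in_cong[OF assms(1)]) (use assms(2) in \<open>auto simp: axis_def\<close>)
  ultimately have "((\<lambda>t::real. F p) has_derivative (\<lambda>t. frechet_derivative F (at p) (t *\<^sub>R ?v))) (at 0)"
    by simp
  from has_derivative_unique[OF this has_derivative_const]
  have "frechet_derivative F (at p) (1 *\<^sub>R ?v) = 0" by metis
  then show ?thesis by simp
qed

lemma frechet_derivative_coordinates:
  assumes "smooth (F :: 'n::{finite,linorder} rvec \<times> 'p::finite rvec \<Rightarrow> real)"
  shows "dird F (u, v) p =
    (\<Sum>l\<in>UNIV. u $ l * dird F (axis l 1, 0) p) + (\<Sum>j\<in>UNIV. v $ j * dird F (0, axis j 1) p)"
proof -
  interpret bounded_linear "frechet_derivative F (at p)"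
    by (rule has_derivative_bounded_linear[OF smooth_has_derivative[OF assms]])
  have u: "(u, 0) = (\<Sum>l\<in>UNIV. u $ l *\<^sub>R (axis l 1, 0::'p rvec))"
    by (simp add: prod_eq_iff fst_sum snd_sum vec_eq_iff axis_def if_distrib cong: if_cong)
  have v: "(0, v) = (\<Sum>j\<in>UNIV. v $ j *\<^sub>R (0::'n rvec, axis j 1))"
    by (simp add: prod_eq_iff fst_sum snd_sum vec_eq_iff axis_def if_distrib cong: if_cong)
  have "dird F (u, v) p = dird F (u, 0) p + dird F (0, v) p"
    using add[of "(u, 0)" "(0, v)"] by simp
  also have "\<dots> = (\<Sum>l\<in>UNIV. u $ l * dird F (axis l 1, 0) p) + (\<Sum>j\<in>UNIV. v $ j * dird F (0, axis j 1) p)"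
    unfolding u v sum scaleR by simp
  finally show ?thesis .
qed

text \<open>Hadamard's lemma with a parameter: integrate the derivative of \<open>t \<mapsto> F (t x, h)\<close> over \<open>[0, 1]\<close>.  The
  cofactors are parameter integrals of partial derivatives of \<open>F\<close>, hence smooth.\<close>
lemma hadamard_factorization:
  assumes F: "smooth_in I F" and F0: "\<And>h. F (0, h) = 0"
  shows "\<exists>H. (\<forall>l. smooth_in I (H l)) \<and> (\<forall>p. F p = (\<Sum>l\<in>I. fst p $ l * H l p))"
proof -
  define D where "D l p t = dird F (axis l 1, 0) (t *\<^sub>R fst p, snd p)" for l p and t :: real
  define H where "H l p = integral {0..1} (D l p)" for l p
  have smD: "smooth (\<lambda>(p, t). D l p t)" for l
  proof -
    have "smooth (\<lambda>q :: ('a rvec \<times> 'b rvec) \<times> real. snd q *\<^sub>R fst (fst q))"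
    proof (rule smooth_vec)
      show "smooth (\<lambda>q :: ('a rvec \<times> 'b rvec) \<times> real. (snd q *\<^sub>R fst (fst q)) $ i)" for i
        unfolding vector_scaleR_component real_scaleR_def
        by (intro smooth_mult smooth_bounded_linear bounded_linear_snd
            bounded_linear_compose[OF bounded_linear_vec_nth]
            bounded_linear_compose[OF bounded_linear_fst] bounded_linear_fst)
    qed
    moreover have "smooth (\<lambda>q :: ('a rvec \<times> 'b rvec) \<times> real. snd (fst q))"
      by (intro smooth_bounded_linear bounded_linear_compose[OF bounded_linear_snd] bounded_linear_fst)
    ultimately show ?thesis
      unfolding D_def case_prod_unfold
      by (intro smooth_compose[OF smooth_dird[OF smooth_in_smooth[OF F]]] smooth_Pair)
  qed
  have intD: "D l p integrable_on {0..1}" for l p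
  proof (rule integrable_continuous_real)
    have "continuous_on {0..1} (\<lambda>t. case (p, t) of (p, t) \<Rightarrow> D l p t)"
      by (rule continuous_on_compose2[OF smooth_continuous[OF smD]]) (auto intro!: continuous_intros)
    then show "continuous_on {0..1} (D l p)" by simp
  qed
  have "smooth_in I (H l)" for l
    unfolding smooth_in_def
  proof (intro conjI allI impI)
    show "smooth (H l)" unfolding H_def using smooth_integral_parameter[OF smD] by simp
    show "H l p = H l q" if "(\<forall>j\<in>I. fst p $ j = fst q $ j) \<and> snd p = snd q" for p q
    proof -
      have "D l p t = D l q t" for t
        unfolding D_def by (rule smooth_in_cong[OF smooth_in_dird[OF F]]) (use that in auto)
      then have "D l p = D l q" by (rule ext)
      then show ?thesis by (simp add: H_def)
    qed
  qed
  moreover have "F p = (\<Sum>l\<in>I. fst p $ l * H l p)" for p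
  proof -
    obtain x h where p: "p = (x, h)" by force
    have H0: "H l p = 0" if "l \<notin> I" for l
    proof -
      have "D l p = (\<lambda>t. 0)"
        unfolding D_def by (rule ext) (rule smooth_in_dird_zero[OF F that])
      then show ?thesis by (simp add: H_def)
    qed
    have "((\<lambda>t. F (t *\<^sub>R x, h)) has_vector_derivative (\<Sum>l\<in>UNIV. x $ l * D l p t)) (at t within {0..1})"
      for t
    proof -
      have "((\<lambda>t. (t *\<^sub>R x, h)) has_derivative (\<lambda>s. (s *\<^sub>R x, 0))) (at t within {0..1})"
        by (auto intro!: derivative_eq_intros)
      from has_derivative_compose[OF this smooth_has_derivative[OF smooth_in_smooth[OF F]]]
      have "((\<lambda>t. F (t *\<^sub>R x, h)) has_derivative
          (\<lambda>s. dird F (s *\<^sub>R x, 0) (t *\<^sub>R x, h))) (at t within {0..1})" .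
      moreover have "dird F (s *\<^sub>R x, 0) (t *\<^sub>R x, h) = s * (\<Sum>l\<in>UNIV. x $ l * D l p t)" for s
        using frechet_derivative_coordinates[OF smooth_in_smooth[OF F], where u="s *\<^sub>R x" and v=0]
        by (simp add: D_def p sum_distrib_left mult.assoc)
      ultimately show ?thesis by (simp add: has_vector_derivative_def)
    qed
    then have "((\<lambda>t. \<Sum>l\<in>UNIV. x $ l * D l p t) has_integral F (1 *\<^sub>R x, h) - F (0 *\<^sub>R x, h)) {0..1}"
      by (intro fundamental_theorem_of_calculus) auto
    then have "F p = integral {0..1} (\<lambda>t. \<Sum>l\<in>UNIV. x $ l * D l p t)"
      by (simp add: F0 p integral_unique)
    also have "\<dots> = (\<Sum>l\<in>UNIV. x $ l * H l p)"
      by (subst integral_sum) (auto simp: H_def intro!: integrable_on_mult_right intD)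
    also have "\<dots> = (\<Sum>l\<in>I. fst p $ l * H l p)"
      using H0 by (intro sum.mono_neutral_cong_right) (auto simp: p)
    finally show ?thesis .
  qed
  ultimately show ?thesis by blast
qed

text \<open>This form supplies a bound whose coefficient is smooth, so it can enter a control law.\<close>
lemma hadamard_square_bound:
  assumes F: "smooth_in I F" and F0: "\<And>h. F (0, h) = 0"
  shows "\<exists>C. smooth_in I C \<and> (\<forall>p. C p \<ge> 0) \<and> (\<forall>p. (F p)\<^sup>2 \<le> C p * (\<Sum>l\<in>I. (fst p $ l)\<^sup>2))"
proof -
  obtain H where H: "\<And>l. smooth_in I (H l)" "\<And>p. F p = (\<Sum>l\<in>I. fst p $ l * H l p)"
    using hadamard_factorization[OF F F0] by blast
  show ?thesis
  proof (intro exI conjI allI)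
    show "smooth_in I (\<lambda>p. \<Sum>l\<in>I. (H l p)\<^sup>2)"
      unfolding power2_eq_square by (intro smooth_in_sum smooth_in_mult H)
    show "0 \<le> (\<Sum>l\<in>I. (H l p)\<^sup>2)" for p by (intro sum_nonneg) simp
    show "(F p)\<^sup>2 \<le> (\<Sum>l\<in>I. (H l p)\<^sup>2) * (\<Sum>l\<in>I. (fst p $ l)\<^sup>2)" for p
      unfolding H(2) using Cauchy_Schwarz_ineq_sum[of "\<lambda>l. fst p $ l" "\<lambda>l. H l p" I]
      by (simp add: mult.commute)
  qed
qed


section \<open>Triangular changes of coordinates\<close>

lemma smooth_diffeo_family_compose:
  assumes "smooth_diffeo_family T" "smooth_diffeo_family U"
  shows "smooth_diffeo_family (\<lambda>p. T (U p, snd p))"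
proof -
  obtain S where S: "smooth S" "\<And>x \<theta>. T (S (x, \<theta>), \<theta>) = x" "\<And>x \<theta>. S (T (x, \<theta>), \<theta>) = x"
    using assms(1) unfolding smooth_diffeo_family_def by metis
  obtain R where R: "smooth R" "\<And>x \<theta>. U (R (x, \<theta>), \<theta>) = x" "\<And>x \<theta>. R (U (x, \<theta>), \<theta>) = x"
    using assms(2) unfolding smooth_diffeo_family_def by metis
  have comp: "smooth (\<lambda>p. F (G p, snd p))" if "smooth F" "smooth G"
    for F G :: "'a \<times> 'b \<Rightarrow> 'a"
    by (intro smooth_compose[OF that(1)] smooth_Pair that(2) smooth_bounded_linear bounded_linear_snd)
  show ?thesis
    unfolding smooth_diffeo_family_def
  proof (intro conjI exI allI)
    show "smooth (\<lambda>p. T (U p, snd p))" "smooth (\<lambda>p. R (S p, snd p))"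
      using assms S(1) R(1) by (auto intro!: comp simp: smooth_diffeo_family_def)
  qed (use assms in \<open>auto simp: smooth_diffeo_family_def S R\<close>)
qed

lemma smooth_diffeo_family_shear:
  assumes "smooth_in (- {b}) a" "\<And>h. a (0, h) = 0"
  shows "smooth_diffeo_family (\<lambda>p. \<chi> i. if i = b then fst p $ i - a p else fst p $ i)"
proof -
  have sm: "smooth (\<lambda>p. \<chi> i. if i = b then fst p $ i + c * a p else fst p $ i)" for c
  proof (rule smooth_vec)
    show "smooth (\<lambda>p. (\<chi> i. if i = b then fst p $ i + c * a p else fst p $ i) $ i)" for i
      using smooth_in_smooth[OF smooth_in_state[of i UNIV]] smooth_in_smooth[OF assms(1)]
      by (cases "i = b") (auto intro!: smooth_add smooth_mult smooth_const)
  qed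
  have inv: "a ((\<chi> i. if i = b then x i else fst p $ i), snd p) = a p" for x p
    by (rule smooth_in_cong[OF assms(1)]) auto
  show ?thesis
    unfolding smooth_diffeo_family_def
  proof (intro conjI exI allI)
    show "smooth (\<lambda>p. \<chi> i. if i = b then fst p $ i - a p else fst p $ i)"
      using sm[of "-1"] by (simp cong: if_cong)
    show "smooth (\<lambda>p. \<chi> i. if i = b then fst p $ i + a p else fst p $ i)"
      using sm[of 1] by (simp cong: if_cong)
  qed (use assms(2) inv[of _ "(_, _)"] in \<open>auto simp: vec_eq_iff\<close>)
qed

text \<open>Subtracting the \<open>a\<^sub>i\<close> is a product of shears, each changing one coordinate by a function of smaller
  ones.  The shear with the largest index acts first: the coordinate that it changes is not an argument
  of the remaining \<open>a\<^sub>i\<close>.\<close>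
lemma smooth_diffeo_family_triangular:
  assumes "\<And>i. smooth_in {..<i} (a i)" "\<And>i h. a i (0, h) = 0"
  shows "smooth_diffeo_family (\<lambda>p. \<chi> i. fst p $ i - a i p)"
proof -
  have "smooth_diffeo_family (\<lambda>p. \<chi> i. if i \<in> A then fst p $ i - a i p else fst p $ i)"
    if "finite A" for A
    using that
  proof (induction A rule: finite_linorder_max_induct)
    case empty
    then show ?case
      using smooth_bounded_linear[OF bounded_linear_fst]
      by (auto simp: smooth_diffeo_family_def intro!: exI[of _ fst])
  next
    case (insert b A)
    define U where "U p = (\<chi> i. if i = b then fst p $ i - a b p else fst p $ i)" for p
    have inv: "a i (U p, snd p) = a i p" if "i \<in> A" for i p
      by (rule smooth_in_cong[OF assms(1)]) (use insert(2) that in \<open>auto simp: U_def\<close>)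
    have "(\<lambda>p. \<chi> i. if i \<in> insert b A then fst p $ i - a i p else fst p $ i) =
        (\<lambda>p. \<chi> i. if i \<in> A then fst (U p, snd p) $ i - a i (U p, snd p) else fst (U p, snd p) $ i)"
      using insert(2) inv by (auto simp: fun_eq_iff vec_eq_iff U_def)
    moreover have "smooth_diffeo_family U"
      unfolding U_def
      by (intro smooth_diffeo_family_shear smooth_in_mono[OF assms(1)] assms(2)) auto
    ultimately show ?case
      using smooth_diffeo_family_compose[OF insert(3)] by simp
  qed
  from this[of UNIV] show ?thesis by simp
qed

section \<open>Virtual controls\<close>

text \<open>\<open>covers l i\<close> stands for \<open>i = l + 1\<close>.  Sums over the at most one \<open>i\<close> (or \<open>l\<close>) with this property replace
  a successor function, so that the ends of the chain need no case distinction.\<close>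
definition covers :: "'n::linorder \<Rightarrow> 'n \<Rightarrow> bool" where
  "covers l i \<longleftrightarrow> l < i \<and> (\<forall>j>l. i \<le> j)"

lemma wf_less_finite: "wf {(l, i :: 'n::{finite,linorder}). l < i}"
proof (rule wf_subset[OF wf_measure[of "\<lambda>i. card {..<i}"]])
  show "{(l, i :: 'n). l < i} \<subseteq> Wellfounded.measure (\<lambda>i. card {..<i})"
    by (auto intro!: psubset_card_mono)
qed

lemma next_coord_covers:
  "next_coord i x (0::real) = (\<Sum>m | covers i m. x $ m)" for i :: "'n::{finite,linorder}"
proof (cases "{j. i < j} = {}")
  case True
  then show ?thesis by (auto simp: next_coord_def covers_def)
next
  case False
  have "covers i m \<longleftrightarrow> m = Min {j. i < j}" for m
    unfolding covers_def using Min_in[OF _ False] Min_le[of "{j. i < j}"]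
    by (auto intro: antisym)
  then show ?thesis unfolding next_coord_def if_not_P[OF False] by simp
qed

lemma covers_unique: "covers l i \<Longrightarrow> covers m i \<Longrightarrow> l = m"
  unfolding covers_def by (meson linorder_neqE not_le)

lemma sum_covers_swap:
  fixes F :: "'n::{finite,linorder} \<Rightarrow> 'n \<Rightarrow> real"
  shows "(\<Sum>i\<in>UNIV. \<Sum>l | covers l i. F i l) = (\<Sum>l\<in>UNIV. \<Sum>i | covers l i. F i l)"
  using sum.swap_restrict[of UNIV UNIV F "\<lambda>i l. covers l i"] by simp

locale backstepping =
  fixes f g :: "'n::{finite,linorder} \<Rightarrow> 'n rvec \<Rightarrow> real"
    and \<phi> :: "'n \<Rightarrow> 'p::finite \<Rightarrow> 'n rvec \<Rightarrow> real"
    and r \<alpha> \<omega> \<epsilon> :: real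
    and \<gamma> :: "'p \<Rightarrow> real"
  assumes f: "\<And>i. smooth (f i)" "\<And>i. depends_upto i (f i)" "\<And>i. f i 0 = 0"
    and g: "\<And>i. smooth (g i)" "\<And>i. depends_upto i (g i)" "\<And>i x. g i x \<noteq> 0"
    and \<phi>: "\<And>i j. smooth (\<phi> i j)" "\<And>i j. depends_upto i (\<phi> i j)" "\<And>i j. \<phi> i j 0 = 0"
    and r: "r \<ge> 0" and \<alpha>: "\<alpha> > 0" and \<omega>: "\<omega> > 0" and \<epsilon>: "\<epsilon> > 0" and \<gamma>: "\<And>j. \<gamma> j > 0"
begin

text \<open>The reference for \<open>x\<^sub>i\<close>: the preceding virtual control, and \<open>0\<close> for the first coordinate.\<close>
definition ref where
  "ref \<beta> i p = (\<Sum>l | covers l i. \<beta> l p)" for \<beta> :: "'n \<Rightarrow> 'n rvec \<times> 'p rvec \<Rightarrow> real"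

definition err where "err \<beta> i p = fst p $ i - ref \<beta> i p"

text \<open>The coefficient of \<open>\<theta>\<^sub>j\<close> in the derivative of the error \<open>err \<beta> i\<close>.\<close>
definition regr where
  "regr \<beta> i j p = \<phi> i j (fst p) - (\<Sum>l<i. dird (ref \<beta> i) (axis l 1, 0) p * \<phi> l j (fst p))"

text \<open>The speed of the reference \<open>ref \<beta> i\<close> caused by the update of the estimate is
  \<open>\<Sum>\<^sub>l err \<beta> l * adapt \<beta> i l\<close>.\<close>
definition adapt where
  "adapt \<beta> i l p = (\<Sum>j\<in>UNIV. \<gamma> j * dird (ref \<beta> i) (0, axis j 1) p * regr \<beta> l j p)"

text \<open>The virtual control \<open>\<beta>\<^sub>i\<close> has to compensate, besides the derivative of the error \<open>i\<close> computed with the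
  estimate in place of \<open>\<theta>\<close>, all couplings of this error with errors of smaller index, including those that
  come from their equations: the contributions \<open>adapt \<beta> l i\<close> of the update to earlier references, and
  the term with \<open>g\<^bsub>i-1\<^esub>\<close> through which the error \<open>i\<close> drives its predecessor.\<close>
definition drift where
  "drift \<beta> i p = f i (fst p)
     - (\<Sum>l<i. dird (ref \<beta> i) (axis l 1, 0) p * (f l (fst p) + g l (fst p) * next_coord l (fst p) 0))
     + (\<Sum>j\<in>UNIV. regr \<beta> i j p * snd p $ j)
     - (\<Sum>l\<le>i. err \<beta> l p * adapt \<beta> i l p)
     - (\<Sum>l<i. err \<beta> l p * adapt \<beta> l i p)
     + (\<Sum>l | covers l i. g l (fst p) * err \<beta> l p)"

text \<open>A smooth upper bound of \<open>sqrt r\<close> plus the norm of the estimate.\<close>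
definition par_size :: "'n rvec \<times> 'p rvec \<Rightarrow> real" where
  "par_size p = sqrt r + 1 + (norm (snd p))\<^sup>2"

text \<open>The requirement on the gain \<open>c\<^sub>i\<close>.  Summed over \<open>i\<close>, the left-hand sides bound everything that the damping
  must absorb.  The surplus on the right is the price of estimating a regressor by all errors up to \<open>i\<close>;
  every square occurs in at most \<open>CARD('n)\<close> of these sums, so that in total the surplus is at most the sum of
  all squares, which the summand \<open>1\<close> on the left pays for.\<close>
definition dominates where
  "dominates \<beta> i c \<longleftrightarrow> (\<forall>p.
     par_size p * \<bar>err \<beta> i p\<bar> * norm (\<chi> j. regr \<beta> i j p)
     + real CARD('n) / (4 * \<epsilon>) * (err \<beta> i p)\<^sup>2 * (norm (\<chi> j. regr \<beta> i j p))\<^sup>2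
     + (\<alpha> + \<omega> + 1) * (err \<beta> i p)\<^sup>2
     \<le> c p * (err \<beta> i p)\<^sup>2 + (\<Sum>l\<le>i. (err \<beta> l p)\<^sup>2) / real CARD('n))"

text \<open>\<open>b\<close> is a correct choice of the virtual control \<open>\<beta>\<^sub>i\<close>, given the previous ones.\<close>
definition step where
  "step \<beta> i b \<longleftrightarrow> smooth_in {..i} b \<and> (\<forall>h. b (0, h) = 0) \<and>
     (\<exists>c. (\<forall>p. g i (fst p) * b p + drift \<beta> i p + c p * err \<beta> i p = 0) \<and> dominates \<beta> i c)"

lemma ref_cong: "(\<And>l. l < i \<Longrightarrow> \<beta> l = \<beta>' l) \<Longrightarrow> ref \<beta> i = ref \<beta>' i"
  unfolding ref_def by (auto intro!: sum.cong simp: covers_def)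

text \<open>The defining conditions of \<open>\<beta>\<^sub>i\<close> involve only earlier virtual controls, as recursion along the order
  of the indices requires.\<close>
lemma step_cong:
  assumes "\<And>l. l < i \<Longrightarrow> \<beta> l = \<beta>' l"
  shows "step \<beta> i b = step \<beta>' i b"
proof -
  have ref: "ref \<beta> l = ref \<beta>' l" if "l \<le> i" for l
    using assms that by (intro ref_cong) auto
  have err: "err \<beta> l = err \<beta>' l" if "l \<le> i" for l
    by (rule ext) (simp only: err_def ref[OF that])
  have regr: "regr \<beta> l j = regr \<beta>' l j" if "l \<le> i" for l j
    by (rule ext) (simp only: regr_def ref[OF that])
  have adapt: "adapt \<beta> l m = adapt \<beta>' l m" if "l \<le> i" "m \<le> i" for l m
    by (rule ext) (simp only: adapt_def ref[OF that(1)] regr[OF that(2)])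
  have "drift \<beta> i = drift \<beta>' i"
    unfolding drift_def fun_eq_iff
    by (auto intro!: sum.cong arg_cong2[of _ _ _ _ "(+)"] arg_cong2[of _ _ _ _ "(-)"]
        simp: ref regr err adapt covers_def)
  moreover have "(\<Sum>l\<le>i. (err \<beta> l p)\<^sup>2) = (\<Sum>l\<le>i. (err \<beta>' l p)\<^sup>2)" for p
    by (intro sum.cong) (auto simp: err)
  ultimately show ?thesis
    by (simp add: step_def dominates_def err regr)
qed

definition admissible :: "'n \<Rightarrow> ('n rvec \<times> 'p rvec \<Rightarrow> real) \<Rightarrow> bool" where
  "admissible l b \<longleftrightarrow> smooth_in {..l} b \<and> (\<forall>h. b (0, h) = 0)"

lemma admissible_ref:
  assumes "\<And>l. l < i \<Longrightarrow> admissible l (\<beta> l)"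
  shows "smooth_in {..<i} (ref \<beta> i)" "ref \<beta> i (0, h) = 0"
proof -
  have ref: "ref \<beta> i = (\<lambda>p. \<Sum>l | covers l i. \<beta> l p)" by (simp add: ref_def fun_eq_iff)
  show "smooth_in {..<i} (ref \<beta> i)"
    unfolding ref
  proof (rule smooth_in_sum)
    fix l assume "l \<in> {l. covers l i}"
    then show "smooth_in {..<i} (\<beta> l)"
      using assms[of l] by (auto simp: admissible_def covers_def intro: smooth_in_mono)
  qed
  show "ref \<beta> i (0, h) = 0"
    unfolding ref using assms by (auto intro!: sum.neutral simp: covers_def admissible_def)
qed

lemma regr_zero: "regr \<beta> l j (0, h) = 0"
  by (simp add: regr_def \<phi>)

context
  fixes \<beta> :: "'n \<Rightarrow> 'n rvec \<times> 'p rvec \<Rightarrow> real" and i :: 'n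
  assumes adm: "\<And>l. l < i \<Longrightarrow> admissible l (\<beta> l)"
begin

lemma ref_smooth: "l \<le> i \<Longrightarrow> smooth_in {..<l} (ref \<beta> l)"
  and ref_zero: "l \<le> i \<Longrightarrow> ref \<beta> l (0, h) = 0"
  using adm by (auto intro!: admissible_ref)

lemma err_smooth:
  assumes "l \<le> m" "l \<le> i"
  shows "smooth_in {..m} (err \<beta> l)"
proof -
  have "smooth_in {..m} (\<lambda>p. fst p $ l - ref \<beta> l p)"
    using assms
    by (intro smooth_in_diff smooth_in_state smooth_in_mono[OF ref_smooth]) auto
  then show ?thesis by (simp add: err_def[abs_def])
qed

lemma dird_ref_smooth: "l \<le> i \<Longrightarrow> l \<le> m \<Longrightarrow> smooth_in {..m} (dird (ref \<beta> l) v)"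
  by (rule smooth_in_mono[OF smooth_in_dird[OF ref_smooth]]) auto

lemma regr_smooth:
  assumes "l \<le> m" "l \<le> i"
  shows "smooth_in {..m} (regr \<beta> l j)"
proof -
  have "smooth_in {..m} (\<lambda>p. \<phi> l j (fst p) - (\<Sum>k<l. dird (ref \<beta> l) (axis k 1, 0) p * \<phi> k j (fst p)))"
    using assms
    by (intro smooth_in_diff smooth_in_sum smooth_in_mult dird_ref_smooth
        smooth_in_depends_upto[OF \<phi>(1,2)]) auto
  then show ?thesis by (simp add: regr_def[abs_def])
qed

lemma err_zero: "l \<le> i \<Longrightarrow> err \<beta> l (0, h) = 0"
  by (simp add: err_def ref_zero)

lemma adapt_smooth:
  assumes "k \<le> i" "l \<le> i"
  shows "smooth_in {..i} (adapt \<beta> k l)"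
proof -
  have "smooth_in {..i} (\<lambda>p. \<Sum>j\<in>UNIV. \<gamma> j * dird (ref \<beta> k) (0, axis j 1) p * regr \<beta> l j p)"
    using assms
    by (intro smooth_in_sum smooth_in_mult smooth_in_const dird_ref_smooth regr_smooth) auto
  then show ?thesis by (simp add: adapt_def[abs_def])
qed

lemma drift_smooth: "smooth_in {..i} (drift \<beta> i)"
proof -
  have nc: "smooth_in {..i} (\<lambda>p. next_coord l (fst p) 0)" if "l < i" for l
    unfolding next_coord_covers
    using that by (intro smooth_in_sum smooth_in_state) (auto simp: covers_def)
  show ?thesis
    unfolding drift_def[abs_def]
    by (intro smooth_in_diff smooth_in_add smooth_in_sum smooth_in_mult nc dird_ref_smooth
        regr_smooth err_smooth adapt_smooth smooth_in_estimate
        smooth_in_depends_upto[OF f(1,2)] smooth_in_depends_upto[OF g(1,2)])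
      (auto simp: covers_def)
qed

lemma drift_zero: "drift \<beta> i (0, h) = 0"
  by (auto simp: drift_def f regr_zero err_zero next_coord_covers covers_def intro!: sum.neutral)

text \<open>\<open>x\<^sub>m\<close> is the error plus a reference that vanishes with \<open>x\<^sub>1, \<dots>, x\<^bsub>m-1\<^esub>\<close>; Hadamard's lemma reduces
  the reference to those coordinates and the induction hypothesis reduces them to errors.\<close>
lemma state_bound:
  "m \<le> i \<Longrightarrow> \<exists>C. smooth_in {..m} C \<and> (\<forall>p. C p \<ge> 0) \<and>
     (\<forall>p. (fst p $ m)\<^sup>2 \<le> C p * (\<Sum>l\<le>m. (err \<beta> l p)\<^sup>2))"
proof (induction m rule: wf_induct_rule[OF wf_less_finite])
  case (1 m)
  have "\<exists>C. \<forall>k<m. smooth_in {..k} (C k) \<and> (\<forall>p. C k p \<ge> 0) \<and>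
     (\<forall>p. (fst p $ k)\<^sup>2 \<le> C k p * (\<Sum>l\<le>k. (err \<beta> l p)\<^sup>2))"
    using 1 by (intro choice) fastforce
  then obtain C where C: "\<And>k. k < m \<Longrightarrow> smooth_in {..k} (C k)" "\<And>k p. k < m \<Longrightarrow> C k p \<ge> 0"
    "\<And>k p. k < m \<Longrightarrow> (fst p $ k)\<^sup>2 \<le> C k p * (\<Sum>l\<le>k. (err \<beta> l p)\<^sup>2)" by blast
  obtain H where H: "smooth_in {..<m} H" "\<And>p. H p \<ge> 0"
    "\<And>p. (ref \<beta> m p)\<^sup>2 \<le> H p * (\<Sum>l<m. (fst p $ l)\<^sup>2)"
    using hadamard_square_bound[OF ref_smooth ref_zero, OF 1(2) 1(2)] by auto
  define K where "K p = 2 + 2 * (H p * (\<Sum>k<m. C k p))" for p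
  show ?case
  proof (intro exI conjI allI)
    show "smooth_in {..m} K"
      unfolding K_def
      by (intro smooth_in_add smooth_in_mult smooth_in_const smooth_in_sum
          smooth_in_mono[OF H(1)] smooth_in_mono[OF C(1)]) auto
    show K0: "K p \<ge> 0" for p
      unfolding K_def by (intro add_nonneg_nonneg mult_nonneg_nonneg sum_nonneg H C) auto
    fix p
    define Z where "Z = (\<Sum>l\<le>m. (err \<beta> l p)\<^sup>2)"
    have "(fst p $ k)\<^sup>2 \<le> C k p * Z" if "k < m" for k
    proof -
      have "(\<Sum>l\<le>k. (err \<beta> l p)\<^sup>2) \<le> Z"
        unfolding Z_def using that by (intro sum_mono2) auto
      from order_trans[OF C(3)[OF that] mult_left_mono[OF this C(2)[OF that]]] show ?thesis .
    qed
    then have "(\<Sum>l<m. (fst p $ l)\<^sup>2) \<le> (\<Sum>k<m. C k p) * Z"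
      unfolding sum_distrib_right by (intro sum_mono) auto
    from order_trans[OF H(3) mult_left_mono[OF this H(2)]]
    have 1: "(ref \<beta> m p)\<^sup>2 \<le> H p * (\<Sum>k<m. C k p) * Z"
      by (simp add: mult.assoc)
    have "(err \<beta> m p)\<^sup>2 \<le> Z"
      unfolding Z_def by (rule member_le_sum) auto
    moreover have "(fst p $ m)\<^sup>2 \<le> 2 * (err \<beta> m p)\<^sup>2 + 2 * (ref \<beta> m p)\<^sup>2"
    proof -
      have "fst p $ m = err \<beta> m p + ref \<beta> m p" by (simp add: err_def)
      then show ?thesis
        using zero_le_power2[of "err \<beta> m p - ref \<beta> m p"] by (simp add: power2_sum power2_diff)
    qed
    ultimately show "(fst p $ m)\<^sup>2 \<le> K p * (\<Sum>l\<le>m. (err \<beta> l p)\<^sup>2)"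
      using 1 unfolding Z_def[symmetric] K_def by (simp add: algebra_simps)
  qed
qed

lemma error_bound:
  assumes F: "smooth_in {..i} F" and F0: "\<And>h. F (0, h) = 0"
  shows "\<exists>C. smooth_in {..i} C \<and> (\<forall>p. (F p)\<^sup>2 \<le> C p * (\<Sum>l\<le>i. (err \<beta> l p)\<^sup>2))"
proof -
  obtain H where H: "smooth_in {..i} H" "\<And>p. H p \<ge> 0"
    "\<And>p. (F p)\<^sup>2 \<le> H p * (\<Sum>l\<le>i. (fst p $ l)\<^sup>2)"
    using hadamard_square_bound[OF F F0] by blast
  have "\<exists>C. \<forall>k\<le>i. smooth_in {..k} (C k) \<and> (\<forall>p. C k p \<ge> 0) \<and>
     (\<forall>p. (fst p $ k)\<^sup>2 \<le> C k p * (\<Sum>l\<le>k. (err \<beta> l p)\<^sup>2))"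
    using state_bound by (intro choice) blast
  then obtain C where C: "\<And>k. k \<le> i \<Longrightarrow> smooth_in {..k} (C k)" "\<And>k p. k \<le> i \<Longrightarrow> C k p \<ge> 0"
    "\<And>k p. k \<le> i \<Longrightarrow> (fst p $ k)\<^sup>2 \<le> C k p * (\<Sum>l\<le>k. (err \<beta> l p)\<^sup>2)" by blast
  show ?thesis
  proof (intro exI conjI allI)
    show "smooth_in {..i} (\<lambda>p. H p * (\<Sum>k\<le>i. C k p))"
      by (intro smooth_in_mult smooth_in_sum H smooth_in_mono[OF C(1)]) auto
    fix p
    define Z where "Z = (\<Sum>l\<le>i. (err \<beta> l p)\<^sup>2)"
    have "(fst p $ k)\<^sup>2 \<le> C k p * Z" if "k \<le> i" for k
    proof -
      have "(\<Sum>l\<le>k. (err \<beta> l p)\<^sup>2) \<le> Z"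
        unfolding Z_def using that by (intro sum_mono2) auto
      from order_trans[OF C(3)[OF that] mult_left_mono[OF this C(2)[OF that]]] show ?thesis .
    qed
    then have "(\<Sum>l\<le>i. (fst p $ l)\<^sup>2) \<le> (\<Sum>k\<le>i. C k p) * Z"
      unfolding sum_distrib_right by (intro sum_mono) auto
    from order_trans[OF H(3) mult_left_mono[OF this H(2)]]
    show "(F p)\<^sup>2 \<le> H p * (\<Sum>k\<le>i. C k p) * (\<Sum>l\<le>i. (err \<beta> l p)\<^sup>2)"
      by (simp add: Z_def mult.assoc)
  qed
qed

text \<open>The control is obtained by solving the affine equation in \<open>b\<close>.  The gain consists of the required
  constant, a multiple of \<open>|W|\<^sup>2\<close> for the term that Young's inequality leaves, and a multiple of
  \<open>par_size\<^sup>2\<close> times the coefficient of \<open>error_bound\<close>.\<close>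
lemma step_exists: "\<exists>b. step \<beta> i b"
proof -
  define N where "N = real CARD('n)"
  have N: "N > 0" by (simp add: N_def)
  have "\<exists>C. \<forall>j. smooth_in {..i} (C j) \<and>
      (\<forall>p. (regr \<beta> i j p)\<^sup>2 \<le> C j p * (\<Sum>l\<le>i. (err \<beta> l p)\<^sup>2))"
    by (intro choice allI error_bound regr_smooth regr_zero) auto
  then obtain C where C: "\<And>j. smooth_in {..i} (C j)"
    "\<And>j p. (regr \<beta> i j p)\<^sup>2 \<le> C j p * (\<Sum>l\<le>i. (err \<beta> l p)\<^sup>2)" by blast
  define c where "c p = (\<alpha> + \<omega> + 1) + N / (4 * \<epsilon>) * (\<Sum>j\<in>UNIV. (regr \<beta> i j p)\<^sup>2)
    + N / 4 * ((par_size p)\<^sup>2 * (\<Sum>j\<in>UNIV. C j p))" for p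
  define b where "b p = - 1 * (drift \<beta> i p + c p * err \<beta> i p) * inverse (g i (fst p))" for p
  have "smooth_in {..i} par_size"
    unfolding par_size_def[abs_def] power2_norm_vec unfolding power2_eq_square
    by (intro smooth_in_add smooth_in_const smooth_in_sum smooth_in_mult smooth_in_estimate)
  then have c: "smooth_in {..i} c"
    unfolding c_def[abs_def] power2_eq_square
    by (intro smooth_in_add smooth_in_const smooth_in_sum smooth_in_mult regr_smooth C) auto
  have "smooth_in {..i} b"
    unfolding b_def[abs_def] using g(3)
    by (intro smooth_in_mult smooth_in_add smooth_in_const smooth_in_inverse drift_smooth c err_smooth
        smooth_in_depends_upto[OF g(1,2)]) auto
  moreover have "b (0, h) = 0" for h
    by (simp add: b_def drift_zero err_zero)
  moreover have "g i (fst p) * b p + drift \<beta> i p + c p * err \<beta> i p = 0" for p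
    using g(3)[of i "fst p"] by (simp add: b_def field_simps)
  moreover have "dominates \<beta> i c"
    unfolding dominates_def N_def[symmetric]
  proof
    fix p
    define z where "z = err \<beta> i p"
    define s where "s = par_size p"
    define R where "R = norm (\<chi> j. regr \<beta> i j p)"
    define Z where "Z = (\<Sum>l\<le>i. (err \<beta> l p)\<^sup>2)"
    define G where "G = (\<Sum>j\<in>UNIV. C j p)"
    have s: "s \<ge> 0" using r by (simp add: s_def par_size_def add_nonneg_nonneg)
    have R2: "R\<^sup>2 = (\<Sum>j\<in>UNIV. (regr \<beta> i j p)\<^sup>2)" by (simp add: R_def power2_norm_vec)
    have RG: "R\<^sup>2 \<le> G * Z"
      unfolding R2 G_def Z_def sum_distrib_right by (intro sum_mono C)
    have Z: "Z \<ge> 0" unfolding Z_def by (intro sum_nonneg) auto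
    have "G * Z \<ge> 0" by (rule order_trans[OF zero_le_power2 RG])
    then have G: "G \<ge> 0 \<or> Z = 0"
      using Z by (auto simp: zero_le_mult_iff)
    \<comment> \<open>the coefficient \<open>G\<close> of the bound may be negative only where all errors vanish\<close>
    have "s * \<bar>z\<bar> * R \<le> N / 4 * (s\<^sup>2 * G) * z\<^sup>2 + Z / N"
    proof (cases "Z = 0")
      case True
      then have "R = 0" using RG by simp
      moreover have "z = 0"
        using True unfolding Z_def z_def by (subst (asm) sum_nonneg_eq_0_iff) auto
      ultimately show ?thesis using True by simp
    next
      case False
      then have "G \<ge> 0" using G by simp
      define X where "X = N / 4 * (s\<^sup>2 * G) * z\<^sup>2"
      define Y where "Y = Z / N"
      have "X \<ge> 0" "Y \<ge> 0" using N Z \<open>G \<ge> 0\<close> by (auto simp: X_def Y_def)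
      \<comment> \<open>arithmetic-geometric mean inequality; \<open>N / 4\<close> in the gain is what \<open>4 X Y\<close> requires\<close>
      have "(s * \<bar>z\<bar> * R)\<^sup>2 = s\<^sup>2 * z\<^sup>2 * R\<^sup>2" by (simp add: power_mult_distrib)
      also have "\<dots> \<le> s\<^sup>2 * z\<^sup>2 * (G * Z)" using RG by (intro mult_left_mono) auto
      also have "\<dots> = 4 * X * Y" using N by (simp add: X_def Y_def field_simps)
      also have "\<dots> \<le> (X + Y)\<^sup>2"
        using zero_le_power2[of "X - Y"] by (simp add: power2_sum power2_diff)
      finally have "s * \<bar>z\<bar> * R \<le> X + Y"
        by (rule power2_le_imp_le) (use \<open>X \<ge> 0\<close> \<open>Y \<ge> 0\<close> in auto)
      then show ?thesis by (simp add: X_def Y_def)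
    qed
    then have "s * \<bar>z\<bar> * R + N / (4 * \<epsilon>) * z\<^sup>2 * R\<^sup>2 + (\<alpha> + \<omega> + 1) * z\<^sup>2 \<le> c p * z\<^sup>2 + Z / N"
      unfolding c_def R2[symmetric] s_def[symmetric] G_def[symmetric] by (simp add: algebra_simps)
    then show "par_size p * \<bar>err \<beta> i p\<bar> * norm (\<chi> j. regr \<beta> i j p)
       + N / (4 * \<epsilon>) * (err \<beta> i p)\<^sup>2 * (norm (\<chi> j. regr \<beta> i j p))\<^sup>2 + (\<alpha> + \<omega> + 1) * (err \<beta> i p)\<^sup>2
       \<le> c p * (err \<beta> i p)\<^sup>2 + (\<Sum>l\<le>i. (err \<beta> l p)\<^sup>2) / N"
      by (simp add: z_def s_def R_def Z_def)
  qed
  ultimately show ?thesis unfolding step_def by blast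
qed

end

lemma virtual_controls_exist: "\<exists>\<beta>. \<forall>i. step \<beta> i (\<beta> i)"
proof (rule dependent_wf_choice[OF wf_less_finite])
  show "step \<beta> i b = step \<beta>' i b" if "\<And>l. (l, i) \<in> {(l, i). l < i} \<Longrightarrow> \<beta> l = \<beta>' l" for \<beta> \<beta>' i b
    using that by (intro step_cong) auto
  show "\<exists>b. step \<beta> i b" if "\<And>l. (l, i) \<in> {(l, i). l < i} \<Longrightarrow> step \<beta> l (\<beta> l)" for \<beta> i
    using that by (intro step_exists) (auto simp: step_def admissible_def)
qed

end


section \<open>The closed loop in error coordinates\<close>

text \<open>Each product \<open>z\<^sub>i z\<^sub>l\<close> on the right is attributed to the larger of its two indices, the diagonal to
  itself.\<close>
lemma sum_coupling_by_larger_index: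
  fixes z :: "'n::{finite,linorder} \<Rightarrow> real"
  shows "(\<Sum>i\<in>UNIV. z i * ((\<Sum>l\<le>i. z l * A i l) + (\<Sum>l<i. z l * A l i))) =
    (\<Sum>i\<in>UNIV. z i * (\<Sum>l\<in>UNIV. z l * A i l))"
proof -
  have "(\<Sum>i\<in>UNIV. \<Sum>l<i. z i * (z l * A l i)) = (\<Sum>i\<in>UNIV. \<Sum>l\<in>{l. i < l}. z i * (z l * A i l))"
    using sum.swap_restrict[of UNIV UNIV "\<lambda>i l. z i * (z l * A l i)" "\<lambda>i l. l < i"]
    by (simp add: lessThan_def mult.left_commute)
  moreover have "(\<Sum>l\<in>UNIV. z l * A i l) = (\<Sum>l\<le>i. z l * A i l) + (\<Sum>l\<in>{l. i < l}. z l * A i l)" for i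
    by (subst sum.union_disjoint[symmetric]) (auto intro!: sum.cong)
  ultimately show ?thesis
    by (simp add: distrib_left sum.distrib sum_distrib_left)
qed

context backstepping
begin

text \<open>For \<open>\<rho> \<le> sqrt r\<close> the first term suffices.  Otherwise Young's inequality splits
  \<open>q (\<rho> - sqrt r)\<close>, and \<open>(\<rho> - sqrt r)\<^sup>2 \<le> \<rho>\<^sup>2 - r\<close>.\<close>
lemma robust_young:
  fixes q \<rho> :: real
  assumes "q \<ge> 0" "\<rho> \<ge> 0"
  shows "q * \<rho> \<le> sqrt r * q + q\<^sup>2 / (4 * \<epsilon>) + \<epsilon> * max (\<rho>\<^sup>2 - r) 0"
proof (cases "\<rho> \<le> sqrt r")
  case True
  have "q * \<rho> \<le> sqrt r * q" using mult_left_mono[OF True assms(1)] by (simp add: mult.commute)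
  moreover have "0 \<le> q\<^sup>2 / (4 * \<epsilon>)" "0 \<le> \<epsilon> * max (\<rho>\<^sup>2 - r) 0" using \<epsilon> by auto
  ultimately show ?thesis by linarith
next
  case False
  define s where "s = sqrt r"
  have s: "s \<ge> 0" "s\<^sup>2 = r" "s < \<rho>" using r False by (auto simp: s_def)
  have "s * (\<rho> - s) \<ge> 0" using s by simp
  then have "(\<rho> - s)\<^sup>2 \<le> \<rho>\<^sup>2 - r" by (simp add: power2_eq_square algebra_simps s(2)[symmetric])
  then have 1: "\<epsilon> * (\<rho> - s)\<^sup>2 \<le> \<epsilon> * max (\<rho>\<^sup>2 - r) 0"
    using \<epsilon> by (intro mult_left_mono) auto
  have "0 \<le> (q - 2 * \<epsilon> * (\<rho> - s))\<^sup>2 / (4 * \<epsilon>)" using \<epsilon> by simp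
  also have "\<dots> = q\<^sup>2 / (4 * \<epsilon>) - q * (\<rho> - s) + \<epsilon> * (\<rho> - s)\<^sup>2"
    using \<epsilon> by (simp add: power2_eq_square field_simps)
  finally show ?thesis using 1 unfolding s_def[symmetric] by (simp add: algebra_simps)
qed

context
  fixes \<beta> :: "'n \<Rightarrow> 'n rvec \<times> 'p rvec \<Rightarrow> real"
  assumes step: "\<And>i. step \<beta> i (\<beta> i)"
begin

definition control :: "'n rvec \<times> 'p rvec \<Rightarrow> real" where
  "control = \<beta> (Max UNIV)"

text \<open>The sum of the regressors weighted by the errors: the coefficient of \<open>\<theta>\<close> in the derivative of
  \<open>|errs|\<^sup>2 / 2\<close>.\<close>
definition tuning :: "'n rvec \<times> 'p rvec \<Rightarrow> 'p rvec" where
  "tuning p = (\<chi> j. \<Sum>i\<in>UNIV. err \<beta> i p * regr \<beta> i j p)"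

definition update :: "'n rvec \<times> 'p rvec \<Rightarrow> 'p rvec" where
  "update p = (\<chi> j. \<gamma> j * tuning p $ j)"

definition errs :: "'n rvec \<times> 'p rvec \<Rightarrow> 'n rvec" where
  "errs p = (\<chi> i. err \<beta> i p)"

lemma step_admissible: "admissible l (\<beta> l)"
  using step by (simp add: step_def admissible_def)

lemmas ref_smooth' = admissible_ref(1)[of _ \<beta>, OF step_admissible]
lemmas ref_zero' = admissible_ref(2)[of _ \<beta>, OF step_admissible]
lemmas err_smooth' = err_smooth[OF step_admissible order_refl order_refl]
lemmas regr_smooth' = regr_smooth[OF step_admissible order_refl order_refl]

lemma smooth_control: "smooth control"
  unfolding control_def using step_admissible smooth_in_smooth by (auto simp: admissible_def)

lemma smooth_update: "smooth update"
proof (rule smooth_vec)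
  show "smooth (\<lambda>p. update p $ j)" for j
    unfolding update_def tuning_def vec_lambda_beta
    by (intro smooth_mult smooth_const smooth_sum smooth_in_smooth[OF err_smooth']
        smooth_in_smooth[OF regr_smooth'])
qed

lemma control_zero: "control (0, h) = 0"
  using step_admissible by (simp add: control_def admissible_def)

lemma update_zero: "update (0, h) = 0"
  by (simp add: update_def tuning_def regr_zero vec_eq_iff)

text \<open>The next coordinate is its reference, that is the virtual control of the current step, plus its error;
  for the last index there is no error, because the input can be set to the virtual control exactly.\<close>
lemma next_coord_control:
  "next_coord i x (control p) = \<beta> i p + (\<Sum>m | covers i m. err \<beta> m p)" if "x = fst p"
proof (cases "{j. i < j} = {}")
  case True
  then have "\<And>j. j \<le> i" by (auto simp: not_less)
  then have "i = Max UNIV" by (intro Max_eqI[symmetric]) auto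
  moreover have "{m. covers i m} = {}" using True by (auto simp: covers_def)
  ultimately show ?thesis using True by (simp add: next_coord_def control_def)
next
  case False
  have ref: "ref \<beta> m p = \<beta> i p" if "covers i m" for m
  proof -
    have "{l. covers l m} = {i}" using that covers_unique by auto
    then show ?thesis by (simp add: ref_def)
  qed
  obtain m where m: "{m. covers i m} = {m}"
  proof
    show "{m. covers i m} = {Min {j. i < j}}"
      unfolding covers_def using Min_in[OF _ False] Min_le[of "{j. i < j}"]
      by (auto intro: antisym)
  qed
  have "next_coord i x (control p) = next_coord i x 0"
    using False by (simp only: next_coord_def if_False)
  also have "\<dots> = fst p $ m" by (simp add: next_coord_covers m that)
  also have "\<dots> = \<beta> i p + err \<beta> m p" using ref m by (force simp: err_def)
  finally show ?thesis by (simp add: m)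
qed

text \<open>The compensation built into \<open>drift\<close> leaves the damping, the parameter error, and two brackets.
  Multiplied by the errors and summed over \<open>i\<close>, each bracket cancels.\<close>
lemma error_dynamics:
  fixes \<theta> :: "'p rvec" and p :: "'n rvec \<times> 'p rvec"
  defines "F \<equiv> closed_loop f g \<phi> control update \<theta> p"
  assumes c: "g i (fst p) * \<beta> i p + drift \<beta> i p + c * err \<beta> i p = 0"
  shows "fst F $ i - dird (ref \<beta> i) F p =
    - c * err \<beta> i p + (\<Sum>j\<in>UNIV. regr \<beta> i j p * (\<theta> $ j - snd p $ j))
    + ((\<Sum>l\<le>i. err \<beta> l p * adapt \<beta> i l p) + (\<Sum>l<i. err \<beta> l p * adapt \<beta> l i p)
        - (\<Sum>l\<in>UNIV. err \<beta> l p * adapt \<beta> i l p))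
    + ((\<Sum>m | covers i m. g i (fst p) * err \<beta> m p) - (\<Sum>l | covers l i. g l (fst p) * err \<beta> l p))"
proof -
  define x where "x = fst p"
  define d where "d l = dird (ref \<beta> i) (axis l 1, 0) p" for l
  have F: "F = (strict_feedback f g \<phi> \<theta> x (control p), update p)"
    by (simp add: F_def closed_loop_def x_def case_prod_unfold)
  have d0: "d l = 0" if "\<not> l < i" for l
    unfolding d_def by (rule smooth_in_dird_zero[OF ref_smooth']) (use that in auto)
  have "(\<Sum>l\<in>UNIV. strict_feedback f g \<phi> \<theta> x (control p) $ l * d l) =
      (\<Sum>l<i. strict_feedback f g \<phi> \<theta> x (control p) $ l * d l)"
    by (rule sum.mono_neutral_right) (auto simp: d0)
  also have "\<dots> = (\<Sum>l<i. d l * (f l x + g l x * next_coord l x 0) + d l * (\<Sum>j\<in>UNIV. \<phi> l j x * \<theta> $ j))"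
  proof (rule sum.cong)
    fix l assume "l \<in> {..<i}"
    then have "{j. l < j} \<noteq> {}" by auto
    then have "next_coord l x (control p) = next_coord l x 0" by (simp only: next_coord_def if_False)
    then show "strict_feedback f g \<phi> \<theta> x (control p) $ l * d l =
      d l * (f l x + g l x * next_coord l x 0) + d l * (\<Sum>j\<in>UNIV. \<phi> l j x * \<theta> $ j)"
      by (simp add: strict_feedback_def algebra_simps)
  qed simp
  also have "\<dots> = (\<Sum>l<i. d l * (f l x + g l x * next_coord l x 0))
      + (\<Sum>j\<in>UNIV. (\<Sum>l<i. d l * \<phi> l j x) * \<theta> $ j)"
    unfolding sum.distrib sum_distrib_left sum_distrib_right
    by (subst (2) sum.swap) (simp add: mult.assoc)
  finally have A: "(\<Sum>l\<in>UNIV. strict_feedback f g \<phi> \<theta> x (control p) $ l * d l) = \<dots>" .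
  have "(\<Sum>j\<in>UNIV. update p $ j * dird (ref \<beta> i) (0, axis j 1) p) =
      (\<Sum>j\<in>UNIV. \<Sum>l\<in>UNIV. err \<beta> l p * (\<gamma> j * dird (ref \<beta> i) (0, axis j 1) p * regr \<beta> l j p))"
    by (simp add: update_def tuning_def sum_distrib_left sum_distrib_right mult_ac)
  also have "\<dots> = (\<Sum>l\<in>UNIV. err \<beta> l p * adapt \<beta> i l p)"
    by (subst sum.swap) (simp add: adapt_def sum_distrib_left)
  finally have B: "(\<Sum>j\<in>UNIV. update p $ j * dird (ref \<beta> i) (0, axis j 1) p) = \<dots>" .
  have C: "(\<Sum>j\<in>UNIV. regr \<beta> i j p * \<theta> $ j) =
      (\<Sum>j\<in>UNIV. \<phi> i j x * \<theta> $ j) - (\<Sum>j\<in>UNIV. (\<Sum>l<i. d l * \<phi> l j x) * \<theta> $ j)"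
    by (simp add: regr_def d_def x_def left_diff_distrib sum_subtractf)
  have D: "dird (ref \<beta> i) F p = (\<Sum>l\<in>UNIV. strict_feedback f g \<phi> \<theta> x (control p) $ l * d l)
      + (\<Sum>l\<in>UNIV. err \<beta> l p * adapt \<beta> i l p)"
    unfolding F B[symmetric] d_def
    by (rule frechet_derivative_coordinates[OF smooth_in_smooth[OF ref_smooth']])
  have E: "fst F $ i = f i x + g i x * \<beta> i p + (\<Sum>m | covers i m. g i x * err \<beta> m p)
      + (\<Sum>j\<in>UNIV. \<phi> i j x * \<theta> $ j)"
    by (simp add: F strict_feedback_def next_coord_control[OF x_def] distrib_left sum_distrib_left)
  have G: "(\<Sum>j\<in>UNIV. regr \<beta> i j p * (\<theta> $ j - snd p $ j)) =
      (\<Sum>j\<in>UNIV. regr \<beta> i j p * \<theta> $ j) - (\<Sum>j\<in>UNIV. regr \<beta> i j p * snd p $ j)"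
    by (simp add: right_diff_distrib sum_subtractf)
  show ?thesis
    using c unfolding drift_def D A E G C d_def[symmetric] x_def[symmetric] by linarith
qed

lemma damping_exists:
  "\<exists>c. (\<forall>i p. g i (fst p) * \<beta> i p + drift \<beta> i p + c i p * err \<beta> i p = 0) \<and>
     (\<forall>i. dominates \<beta> i (c i))"
  using step unfolding step_def by metis

lemma norm_errs: "(norm (errs p))\<^sup>2 = (\<Sum>i\<in>UNIV. (err \<beta> i p)\<^sup>2)"
  by (simp add: power2_norm_vec errs_def)

lemma errs_has_derivative:
  "((\<lambda>p. 1/2 * (norm (errs p))\<^sup>2) has_derivative
    (\<lambda>v. \<Sum>i\<in>UNIV. err \<beta> i p * (fst v $ i - dird (ref \<beta> i) v p))) (at p)"
proof -
  have "(err \<beta> i has_derivative (\<lambda>v. fst v $ i - dird (ref \<beta> i) v p)) (at p)" for i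
    unfolding err_def[abs_def]
    by (intro has_derivative_diff smooth_has_derivative smooth_in_smooth[OF ref_smooth']
        bounded_linear.has_derivative[OF bounded_linear_vec_nth] has_derivative_fst has_derivative_ident)
  note [derivative_intros] = this
  show ?thesis
    unfolding norm_errs sum_distrib_left
    by (auto intro!: derivative_eq_intros simp: power2_eq_square)
qed

lemma lie_errs:
  assumes c: "\<And>i p. g i (fst p) * \<beta> i p + drift \<beta> i p + c i p * err \<beta> i p = 0"
  shows "lie_derivative (\<lambda>p. 1/2 * (norm (errs p))\<^sup>2) (closed_loop f g \<phi> control update \<theta>) p =
    - (\<Sum>i\<in>UNIV. c i p * (err \<beta> i p)\<^sup>2) + tuning p \<bullet> (\<theta> - snd p)"
proof -
  define F where "F = closed_loop f g \<phi> control update \<theta> p"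
  define z where "z i = err \<beta> i p" for i
  define G where "G i = g i (fst p)" for i
  have "lie_derivative (\<lambda>p. 1/2 * (norm (errs p))\<^sup>2) (closed_loop f g \<phi> control update \<theta>) p =
      (\<Sum>i\<in>UNIV. z i * (fst F $ i - dird (ref \<beta> i) F p))"
    unfolding lie_derivative_def frechet_derivative_at[OF errs_has_derivative, symmetric]
    by (simp add: F_def z_def)
  also have "\<dots> = (\<Sum>i\<in>UNIV. - (c i p * (z i)\<^sup>2))
      + (\<Sum>i\<in>UNIV. z i * (\<Sum>j\<in>UNIV. regr \<beta> i j p * (\<theta> $ j - snd p $ j)))
      + ((\<Sum>i\<in>UNIV. z i * ((\<Sum>l\<le>i. z l * adapt \<beta> i l p) + (\<Sum>l<i. z l * adapt \<beta> l i p)))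
        - (\<Sum>i\<in>UNIV. z i * (\<Sum>l\<in>UNIV. z l * adapt \<beta> i l p)))
      + ((\<Sum>i\<in>UNIV. \<Sum>m | covers i m. z i * G i * z m) - (\<Sum>i\<in>UNIV. \<Sum>l | covers l i. z i * G l * z l))"
    unfolding sum.distrib[symmetric] sum_subtractf[symmetric]
  proof (rule sum.cong)
    fix i
    show "z i * (fst F $ i - dird (ref \<beta> i) F p) = - (c i p * (z i)\<^sup>2)
      + z i * (\<Sum>j\<in>UNIV. regr \<beta> i j p * (\<theta> $ j - snd p $ j))
      + (z i * ((\<Sum>l\<le>i. z l * adapt \<beta> i l p) + (\<Sum>l<i. z l * adapt \<beta> l i p))
        - z i * (\<Sum>l\<in>UNIV. z l * adapt \<beta> i l p))
      + ((\<Sum>m | covers i m. z i * G i * z m) - (\<Sum>l | covers l i. z i * G l * z l))"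
    proof -
      have 1: "(\<Sum>m | covers i m. z i * G i * z m) = z i * (\<Sum>m | covers i m. G i * z m)"
        by (simp add: sum_distrib_left mult.assoc)
      have 2: "(\<Sum>l | covers l i. z i * G l * z l) = z i * (\<Sum>l | covers l i. G l * z l)"
        by (simp add: sum_distrib_left mult.assoc)
      show ?thesis
        unfolding 1 2 F_def error_dynamics[OF c] z_def[symmetric] G_def[symmetric]
        by (simp add: algebra_simps power2_eq_square)
    qed
  qed simp
  also have "(\<Sum>i\<in>UNIV. \<Sum>l | covers l i. z i * G l * z l) = (\<Sum>i\<in>UNIV. \<Sum>m | covers i m. z i * G i * z m)"
    by (subst sum_covers_swap) (simp add: mult_ac)
  also have "(\<Sum>i\<in>UNIV. z i * (\<Sum>j\<in>UNIV. regr \<beta> i j p * (\<theta> $ j - snd p $ j))) = tuning p \<bullet> (\<theta> - snd p)"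
    unfolding sum_distrib_left
    by (subst sum.swap) (simp add: inner_vec_def tuning_def z_def sum_distrib_right mult.assoc)
  finally show ?thesis
    unfolding sum_coupling_by_larger_index by (simp add: sum_negf z_def)
qed

text \<open>The update law is chosen such that the derivative of the quadratic form in the estimation error is the
  negative of the parameter term in \<open>lie_errs\<close>.\<close>
lemma lie_V:
  assumes c: "\<And>i p. g i (fst p) * \<beta> i p + drift \<beta> i p + c i p * err \<beta> i p = 0"
  shows "lie_derivative (V_fun errs \<gamma> \<theta>) (closed_loop f g \<phi> control update \<theta>) p =
    - (\<Sum>i\<in>UNIV. c i p * (err \<beta> i p)\<^sup>2)"
proof -
  define F where "F = closed_loop f g \<phi> control update \<theta> p"
  have Q: "((\<lambda>p. \<Sum>j\<in>UNIV. 1 / (2 * \<gamma> j) * (snd p $ j - \<theta> $ j)\<^sup>2) has_derivative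
      (\<lambda>v. \<Sum>j\<in>UNIV. 1 / \<gamma> j * (snd p $ j - \<theta> $ j) * snd v $ j)) (at p)" for p :: "'n rvec \<times> 'p rvec"
  proof -
    have "((\<lambda>p :: 'n rvec \<times> 'p rvec. snd p $ j) has_derivative (\<lambda>v. snd v $ j)) (at p)" for j
      by (intro bounded_linear.has_derivative[OF bounded_linear_vec_nth] has_derivative_snd
          has_derivative_ident)
    note [derivative_intros] = this
    show ?thesis
      using less_imp_neq[OF \<gamma>]
      by (auto intro!: derivative_eq_intros ext sum.cong simp: field_simps power2_eq_square)
  qed
  have V: "V_fun errs \<gamma> \<theta> = (\<lambda>p. 1/2 * (norm (errs p))\<^sup>2 + (\<Sum>j\<in>UNIV. 1 / (2 * \<gamma> j) * (snd p $ j - \<theta> $ j)\<^sup>2))"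
    by (auto simp: V_fun_def)
  have "frechet_derivative (V_fun errs \<gamma> \<theta>) (at p) = (\<lambda>v. dird (\<lambda>p. 1/2 * (norm (errs p))\<^sup>2) v p
      + (\<Sum>j\<in>UNIV. 1 / \<gamma> j * (snd p $ j - \<theta> $ j) * snd v $ j))"
    unfolding V frechet_derivative_at[OF errs_has_derivative, symmetric]
    by (rule frechet_derivative_at[symmetric, OF has_derivative_add[OF errs_has_derivative Q]])
  moreover have "snd F $ j = \<gamma> j * tuning p $ j" for j
    by (simp add: F_def closed_loop_def case_prod_unfold update_def)
  then have "(\<Sum>j\<in>UNIV. 1 / \<gamma> j * (snd p $ j - \<theta> $ j) * snd F $ j) = - (tuning p \<bullet> (\<theta> - snd p))"
    using less_imp_neq[OF \<gamma>]
    by (simp add: inner_vec_def sum_negf[symmetric] algebra_simps cong: sum.cong)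
  ultimately show ?thesis
    using lie_errs[OF c, of \<theta> p] by (simp add: lie_derivative_def F_def)
qed

lemma damping_bound:
  assumes c: "\<And>i. dominates \<beta> i (c i)"
  shows "par_size p * norm (tuning p) + (norm (tuning p))\<^sup>2 / (4 * \<epsilon>) + (\<alpha> + \<omega>) * (norm (errs p))\<^sup>2
    \<le> (\<Sum>i\<in>UNIV. c i p * (err \<beta> i p)\<^sup>2)"
proof -
  define N where "N = real CARD('n)"
  have N: "N > 0" by (simp add: N_def)
  define z where "z i = err \<beta> i p" for i
  define R where "R i = norm (\<chi> j. regr \<beta> i j p)" for i
  have s: "par_size p \<ge> 0" using r by (simp add: par_size_def add_nonneg_nonneg)
  have "tuning p = (\<Sum>i\<in>UNIV. z i *\<^sub>R (\<chi> j. regr \<beta> i j p))"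
    by (simp add: tuning_def vec_eq_iff z_def)
  then have t1: "norm (tuning p) \<le> (\<Sum>i\<in>UNIV. \<bar>z i\<bar> * R i)"
    using norm_sum[of "\<lambda>i. z i *\<^sub>R (\<chi> j. regr \<beta> i j p)" UNIV] by (simp add: R_def)
  then have "(norm (tuning p))\<^sup>2 \<le> (\<Sum>i\<in>UNIV. \<bar>z i\<bar> * R i)\<^sup>2"
    by (intro power_mono) auto
  also have "\<dots> \<le> N * (\<Sum>i\<in>UNIV. (\<bar>z i\<bar> * R i)\<^sup>2)"
    using Cauchy_Schwarz_ineq_sum[of "\<lambda>i. 1" "\<lambda>i. \<bar>z i\<bar> * R i" "UNIV :: 'n set"] by (simp add: N_def)
  finally have t2: "(norm (tuning p))\<^sup>2 \<le> N * (\<Sum>i\<in>UNIV. (z i)\<^sup>2 * (R i)\<^sup>2)"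
    by (simp add: power_mult_distrib)
  have "(\<Sum>i\<in>UNIV. par_size p * \<bar>z i\<bar> * R i + N / (4 * \<epsilon>) * (z i)\<^sup>2 * (R i)\<^sup>2 + (\<alpha> + \<omega> + 1) * (z i)\<^sup>2)
      \<le> (\<Sum>i\<in>UNIV. c i p * (z i)\<^sup>2 + (\<Sum>l\<le>i. (z l)\<^sup>2) / N)"
    using c unfolding dominates_def z_def R_def N_def by (intro sum_mono) blast
  also have "\<dots> \<le> (\<Sum>i\<in>UNIV. c i p * (z i)\<^sup>2 + (norm (errs p))\<^sup>2 / N)"
    unfolding norm_errs z_def[symmetric] using N
    by (intro sum_mono add_left_mono divide_right_mono sum_mono2) auto
  also have "\<dots> = (\<Sum>i\<in>UNIV. c i p * (z i)\<^sup>2) + (norm (errs p))\<^sup>2"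
    using N by (simp add: sum.distrib N_def)
  finally have "par_size p * (\<Sum>i\<in>UNIV. \<bar>z i\<bar> * R i) + (N * (\<Sum>i\<in>UNIV. (z i)\<^sup>2 * (R i)\<^sup>2)) / (4 * \<epsilon>)
      + (\<alpha> + \<omega> + 1) * (norm (errs p))\<^sup>2 \<le> (\<Sum>i\<in>UNIV. c i p * (z i)\<^sup>2) + (norm (errs p))\<^sup>2"
    unfolding norm_errs z_def[symmetric]
    by (simp add: sum.distrib sum_distrib_left mult.assoc sum_divide_distrib mult.left_commute)
  moreover have "par_size p * norm (tuning p) \<le> par_size p * (\<Sum>i\<in>UNIV. \<bar>z i\<bar> * R i)"
    by (rule mult_left_mono[OF t1 s])
  moreover have "(norm (tuning p))\<^sup>2 / (4 * \<epsilon>) \<le> (N * (\<Sum>i\<in>UNIV. (z i)\<^sup>2 * (R i)\<^sup>2)) / (4 * \<epsilon>)"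
    using t2 \<epsilon> by (intro divide_right_mono) auto
  ultimately show ?thesis by (simp add: z_def algebra_simps)
qed

lemma lie_V_le:
  "lie_derivative (V_fun errs \<gamma> \<theta>) (closed_loop f g \<phi> control update \<theta>) p \<le> - \<alpha> * (norm (errs p))\<^sup>2"
proof -
  obtain c where c: "\<And>i p. g i (fst p) * \<beta> i p + drift \<beta> i p + c i p * err \<beta> i p = 0"
    "\<And>i. dominates \<beta> i (c i)" using damping_exists by blast
  have "0 \<le> par_size p * norm (tuning p)"
    using r by (simp add: par_size_def)
  moreover have "0 \<le> (norm (tuning p))\<^sup>2 / (4 * \<epsilon>)" using \<epsilon> by simp
  moreover have "0 \<le> \<omega> * (norm (errs p))\<^sup>2" using \<omega> by simp
  ultimately show ?thesis
    using damping_bound[OF c(2), of p] unfolding lie_V[OF c(1)] by (simp add: algebra_simps)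
qed

lemma lie_errs_le:
  "lie_derivative (\<lambda>p. 1/2 * (norm (errs p))\<^sup>2) (closed_loop f g \<phi> control update \<theta>) p
    \<le> - \<omega> * (norm (errs p))\<^sup>2 + \<epsilon> * max ((norm \<theta>)\<^sup>2 - r) 0"
proof -
  obtain c where c: "\<And>i p. g i (fst p) * \<beta> i p + drift \<beta> i p + c i p * err \<beta> i p = 0"
    "\<And>i. dominates \<beta> i (c i)" using damping_exists by blast
  define q where "q = norm (tuning p)"
  have "tuning p \<bullet> (\<theta> - snd p) \<le> q * (norm \<theta> + norm (snd p))"
    using norm_cauchy_schwarz[of "tuning p" "\<theta> - snd p"] norm_triangle_ineq4[of \<theta> "snd p"]
    unfolding q_def by (meson mult_left_mono norm_ge_zero order_trans)
  moreover have "q * norm \<theta> \<le> sqrt r * q + q\<^sup>2 / (4 * \<epsilon>) + \<epsilon> * max ((norm \<theta>)\<^sup>2 - r) 0"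
    by (rule robust_young) (auto simp: q_def)
  moreover have "q * norm (snd p) \<le> q * (1 + (norm (snd p))\<^sup>2)"
  proof (rule mult_left_mono)
    have "0 \<le> (norm (snd p) - 1)\<^sup>2" by simp
    then have "2 * norm (snd p) \<le> 1 + (norm (snd p))\<^sup>2" by (simp add: power2_diff)
    then show "norm (snd p) \<le> 1 + (norm (snd p))\<^sup>2" using norm_ge_zero[of "snd p"] by linarith
  qed (simp add: q_def)
  moreover have "0 \<le> \<alpha> * (norm (errs p))\<^sup>2" using \<alpha> by simp
  ultimately show ?thesis
    using damping_bound[OF c(2), of p] unfolding lie_errs[OF c(1)] q_def[symmetric] par_size_def
    by (simp add: algebra_simps)
qed

lemma errs_diffeo: "smooth_diffeo_family errs"
  unfolding errs_def[abs_def] err_def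
  by (rule smooth_diffeo_family_triangular[OF ref_smooth' ref_zero'])

end

lemma backstepping_design:
  "\<exists>k w T. smooth k \<and> smooth w \<and> (\<forall>h. k (0, h) = 0 \<and> w (0, h) = 0) \<and> smooth_diffeo_family T \<and>
     (\<forall>\<theta> p.
        lie_derivative (V_fun T \<gamma> \<theta>) (closed_loop f g \<phi> k w \<theta>) p \<le> - \<alpha> * (norm (T p))\<^sup>2 \<and>
        lie_derivative (\<lambda>p. 1/2 * (norm (T p))\<^sup>2) (closed_loop f g \<phi> k w \<theta>) p
          \<le> - \<omega> * (norm (T p))\<^sup>2 + \<epsilon> * max ((norm \<theta>)\<^sup>2 - r) 0)"
proof -
  obtain \<beta> where \<beta>: "\<And>i. step \<beta> i (\<beta> i)" using virtual_controls_exist by blast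
  show ?thesis
    by (intro exI conjI allI) (rule smooth_control[OF \<beta>] smooth_update[OF \<beta>] control_zero[OF \<beta>]
      update_zero[OF \<beta>] errs_diffeo[OF \<beta>] lie_V_le[OF \<beta>] lie_errs_le[OF \<beta>])+
qed

end


section \<open>The adaptive control theorem\<close>

context backstepping
begin

lemma smooth_closed_loop:
  assumes "smooth k" "smooth w"
  shows "smooth (closed_loop f g \<phi> k w \<theta>)"
proof -
  have fst: "smooth (\<lambda>p :: 'n rvec \<times> 'p rvec. H (fst p))" if "smooth H" for H :: "'n rvec \<Rightarrow> real"
    by (intro smooth_compose[OF that] smooth_bounded_linear bounded_linear_fst)
  have nc: "smooth (\<lambda>p. next_coord i (fst p) (k p))" for i
  proof (cases "{j. i < j} = {}")
    case True
    then show ?thesis using assms(1) by (simp only: next_coord_def True refl if_True)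
  next
    case False
    then show ?thesis
      using smooth_in_smooth[OF smooth_in_state[of _ UNIV]] by (simp only: next_coord_def if_False) blast
  qed
  have "smooth (\<lambda>p. strict_feedback f g \<phi> \<theta> (fst p) (k p))"
    unfolding strict_feedback_def
    by (rule smooth_vec, unfold vec_lambda_beta)
      (intro smooth_add smooth_mult smooth_sum smooth_const fst nc f g \<phi>)
  then show ?thesis
    unfolding closed_loop_def case_prod_unfold prod.collapse by (rule smooth_Pair[OF _ assms(2)])
qed

lemma closed_loop_zero:
  assumes "k (0, h) = 0" "w (0, h) = 0"
  shows "closed_loop f g \<phi> k w \<theta> (0, h) = 0"
  by (simp add: closed_loop_def strict_feedback_def next_coord_def assms f \<phi> vec_eq_iff zero_prod_def)

lemma closed_loop_dissipative:
  assumes k: "smooth k" "\<And>h. k (0, h) = 0" and w: "smooth w" "\<And>h. w (0, h) = 0"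
    and T: "smooth_diffeo_family T"
    and lie: "\<And>p. lie_derivative (V_fun T \<gamma> \<theta>) (closed_loop f g \<phi> k w \<theta>) p \<le> - \<alpha> * (norm (T p))\<^sup>2"
      "\<And>p. lie_derivative (\<lambda>p. 1/2 * (norm (T p))\<^sup>2) (closed_loop f g \<phi> k w \<theta>) p
          \<le> - \<omega> * (norm (T p))\<^sup>2 + \<epsilon> * max ((norm \<theta>)\<^sup>2 - r) 0"
  shows "dissipative_loop (closed_loop f g \<phi> k w \<theta>) T
    (\<lambda>p. \<Sum>j\<in>UNIV. 1 / (2 * \<gamma> j) * (snd p $ j - \<theta> $ j)\<^sup>2) \<theta> \<alpha> \<omega>
    (\<epsilon> * max ((norm \<theta>)\<^sup>2 - r) 0) (1 / (2 * (\<Sum>j\<in>UNIV. \<gamma> j)))"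
proof
  let ?Q = "\<lambda>p :: 'n rvec \<times> 'p rvec. \<Sum>j\<in>UNIV. 1 / (2 * \<gamma> j) * (snd p $ j - \<theta> $ j)\<^sup>2"
  \<comment> \<open>each \<open>\<gamma>\<^sub>j\<close> is at most the sum, so this is a lower bound of all weights \<open>1 / (2 \<gamma>\<^sub>j)\<close>\<close>
  let ?q = "1 / (2 * (\<Sum>j\<in>UNIV. \<gamma> j))"
  show "?Q differentiable (at p)" for p
  proof -
    have "smooth (\<lambda>p :: 'n rvec \<times> 'p rvec. snd p $ j + (- \<theta> $ j))" for j
      by (intro smooth_add smooth_const smooth_in_smooth[OF smooth_in_estimate[of UNIV]])
    then have "smooth ?Q"
      unfolding power2_eq_square by (intro smooth_sum smooth_mult smooth_const) simp_all
    then show ?thesis using smooth_has_derivative differentiable_def by blast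
  qed
  have pos: "(\<Sum>j\<in>UNIV. \<gamma> j) > 0" using \<gamma> by (intro sum_pos) auto
  then show "?q > 0" by simp
  show "?q * (norm (snd p - \<theta>))\<^sup>2 \<le> ?Q p" for p
  proof -
    have "?q * (norm (snd p - \<theta>))\<^sup>2 = (\<Sum>j\<in>UNIV. ?q * (snd p $ j - \<theta> $ j)\<^sup>2)"
      unfolding sum_distrib_left[symmetric] by (simp add: power2_norm_vec)
    also have "\<dots> \<le> ?Q p"
    proof (intro sum_mono mult_right_mono)
      fix j
      have "\<gamma> j \<le> (\<Sum>j\<in>UNIV. \<gamma> j)" using \<gamma> by (intro member_le_sum) (auto intro: less_imp_le)
      then show "?q \<le> 1 / (2 * \<gamma> j)" using \<gamma>[of j] by (intro divide_left_mono) auto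
    qed simp
    finally show ?thesis .
  qed
  have V: "V_fun T \<gamma> \<theta> = (\<lambda>p. 1/2 * (norm (T p))\<^sup>2 + ?Q p)" by (auto simp: V_fun_def)
  show "lie_derivative (\<lambda>p. 1/2 * (norm (T p))\<^sup>2 + ?Q p) (closed_loop f g \<phi> k w \<theta>) p
      \<le> - \<alpha> * (norm (T p))\<^sup>2" for p
    using lie(1)[of p] by (simp only: V)
qed (use \<alpha> \<omega> \<epsilon> T lie(2) closed_loop_zero[of k _ w, OF k(2) w(2)] smooth_closed_loop[OF k(1) w(1)] in auto)

end

theorem theorem2:
  fixes f g :: "'n::{finite,linorder} \<Rightarrow> 'n rvec \<Rightarrow> real"
    and \<phi> :: "'n \<Rightarrow> 'p::finite \<Rightarrow> 'n rvec \<Rightarrow> real"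
    and r \<alpha> \<omega> \<epsilon> :: real
    and \<gamma> :: "'p \<Rightarrow> real"
  assumes f: "\<And>i. smooth (f i)" "\<And>i. depends_upto i (f i)" "\<And>i. f i 0 = 0"
    and g: "\<And>i. smooth (g i)" "\<And>i. depends_upto i (g i)" "\<And>i x. g i x \<noteq> 0"
    and \<phi>: "\<And>i j. smooth (\<phi> i j)" "\<And>i j. depends_upto i (\<phi> i j)" "\<And>i j. \<phi> i j 0 = 0"
    and r: "r \<ge> 0" and \<alpha>: "\<alpha> > 0" and \<omega>: "\<omega> > 0" and \<epsilon>: "\<epsilon> > 0" and \<gamma>: "\<And>j. \<gamma> j > 0"
  shows "\<exists>(k :: 'n rvec \<times> 'p rvec \<Rightarrow> real)
           (w :: 'n rvec \<times> 'p rvec \<Rightarrow> 'p rvec)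
           (T :: 'n rvec \<times> 'p rvec \<Rightarrow> 'n rvec).
     smooth k \<and> smooth w \<and> (\<forall>h\<theta>. k (0, h\<theta>) = 0 \<and> w (0, h\<theta>) = 0) \<and>
     smooth_diffeo_family T \<and>
     (\<forall>x h\<theta> \<theta>.
        lie_derivative (V_fun T \<gamma> \<theta>) (closed_loop f g \<phi> k w \<theta>) (x, h\<theta>)
          \<le> - \<alpha> * (norm (T (x, h\<theta>)))\<^sup>2 \<and>
        lie_derivative (\<lambda>z. 1/2 * (norm (T z))\<^sup>2) (closed_loop f g \<phi> k w \<theta>) (x, h\<theta>)
          \<le> - \<omega> * (norm (T (x, h\<theta>)))\<^sup>2 + \<epsilon> * max ((norm \<theta>)\<^sup>2 - r) 0) \<and>
     \<comment> \<open>(i)\<close>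
     (\<forall>\<theta>. equilibria (closed_loop f g \<phi> k w \<theta>) = {(0, h\<theta>) | h\<theta>. True}) \<and>
     \<comment> \<open>(ii)\<close>
     (\<forall>\<theta>. lyapunov_stable (closed_loop f g \<phi> k w \<theta>) (0, \<theta>)) \<and>
     \<comment> \<open>(iii)\<close>
     (\<forall>\<theta>. forward_complete (closed_loop f g \<phi> k w \<theta>) \<and>
          (\<forall>z. solution (closed_loop f g \<phi> k w \<theta>) z \<longrightarrow> bounded (z ` {0..})) \<and>
          lagrange_output_stable (shifted_closed_loop f g \<phi> k w \<theta>) (\<lambda>\<xi> i. fst \<xi> $ i) UNIV) \<and>
     \<comment> \<open>(iv)\<close>
     (\<forall>\<theta>. GAOS (shifted_closed_loop f g \<phi> k w \<theta>) (\<lambda>\<xi> i. fst \<xi> $ i) UNIV \<and>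
          (\<forall>z. solution (closed_loop f g \<phi> k w \<theta>) z \<longrightarrow> ((\<lambda>t. fst (z t)) \<longlongrightarrow> 0) at_top)) \<and>
     \<comment> \<open>(v)\<close>
     (\<forall>\<theta>. norm \<theta> \<le> sqrt r \<longrightarrow>
          UGAOS (shifted_closed_loop f g \<phi> k w \<theta>) (\<lambda>\<xi> i. fst \<xi> $ i) UNIV) \<and>
     \<comment> \<open>(vi)\<close>
     (\<forall>(m::nat) (h :: 'n rvec \<Rightarrow> 'p rvec \<Rightarrow> 'p rvec \<Rightarrow> nat \<Rightarrow> real).
        (\<forall>i<m. continuous_on UNIV (\<lambda>(x, h\<theta>, \<theta>). h x h\<theta> \<theta> i)) \<and>
        (\<exists>b. class_K_inf b \<and>
           (\<forall>x h\<theta> \<theta>. L2_set (h x h\<theta> \<theta>) {..<m}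
              \<le> b (max ((norm (T (x, h\<theta>)))\<^sup>2 - inverse \<omega> * \<epsilon> * max ((norm \<theta>)\<^sup>2 - r) 0) 0))) \<longrightarrow>
        (\<forall>\<theta>. UGAOS (shifted_closed_loop f g \<phi> k w \<theta>)
               (\<lambda>\<xi>. h (fst \<xi>) (snd \<xi> + \<theta>) \<theta>) {..<m}))"
proof -
  interpret backstepping f g \<phi> r \<alpha> \<omega> \<epsilon> \<gamma>
    by unfold_locales (use assms in auto)
  obtain k w T where k: "smooth k" "\<And>h. k (0, h) = 0" and w: "smooth w" "\<And>h. w (0, h) = 0"
    and T: "smooth_diffeo_family T"
    and lie: "\<And>\<theta> p. lie_derivative (V_fun T \<gamma> \<theta>) (closed_loop f g \<phi> k w \<theta>) p \<le> - \<alpha> * (norm (T p))\<^sup>2"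
      "\<And>\<theta> p. lie_derivative (\<lambda>p. 1/2 * (norm (T p))\<^sup>2) (closed_loop f g \<phi> k w \<theta>) p
          \<le> - \<omega> * (norm (T p))\<^sup>2 + \<epsilon> * max ((norm \<theta>)\<^sup>2 - r) 0"
    using backstepping_design by metis
  define Q where "Q \<theta> p = (\<Sum>j\<in>UNIV. 1 / (2 * \<gamma> j) * (snd p $ j - \<theta> $ j)\<^sup>2)"
    for \<theta> and p :: "'n rvec \<times> 'p rvec"
  define \<mu> where "\<mu> \<theta> = \<epsilon> * max ((norm \<theta>)\<^sup>2 - r) 0" for \<theta> :: "'p rvec"
  have D: "dissipative_loop (closed_loop f g \<phi> k w \<theta>) T (Q \<theta>) \<theta> \<alpha> \<omega> (\<mu> \<theta>) (1 / (2 * (\<Sum>j\<in>UNIV. \<gamma> j)))" for \<theta>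
    unfolding Q_def[abs_def] \<mu>_def by (rule closed_loop_dissipative[OF k w T lie])
  have shift: "shifted_closed_loop f g \<phi> k w \<theta> = dissipative_loop.F_shift (closed_loop f g \<phi> k w \<theta>) \<theta>" for \<theta>
    by (simp add: fun_eq_iff shifted_closed_loop_def dissipative_loop.F_shift_def[OF D])
  have sys: "output_system (shifted_closed_loop f g \<phi> k w \<theta>) (\<lambda>\<xi> i. fst \<xi> $ i) UNIV" for \<theta>
    unfolding shift by (rule dissipative_loop.output_system_shift[OF D]) (auto intro!: continuous_intros)
  have norm: "L2_set (\<lambda>i. x $ i) UNIV = norm x" for x :: "'n rvec"
    by (simp add: norm_vec_def L2_set_def)
  have GAOS: "GAOS (shifted_closed_loop f g \<phi> k w \<theta>) (\<lambda>\<xi> i. fst \<xi> $ i) UNIV" for \<theta>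
    unfolding GAOS_def
  proof (intro conjI allI impI ballI)
    fix \<xi> i assume "solution (shifted_closed_loop f g \<phi> k w \<theta>) \<xi>"
    then have "((\<lambda>t. fst (\<xi> t + (0, \<theta>))) \<longlongrightarrow> 0) at_top"
      unfolding shift
      by (rule dissipative_loop.state_tendsto_zero[OF D dissipative_loop.solution_shift[OF D]])
    from tendsto_vec_nth[OF this, of i] show "((\<lambda>t. fst (\<xi> t) $ i) \<longlongrightarrow> 0) at_top" by simp
  qed (unfold shift, (rule dissipative_loop.output_stable[OF D sys[unfolded shift]])+)
  have state: "UGAOS (shifted_closed_loop f g \<phi> k w \<theta>) (\<lambda>\<xi> i. fst \<xi> $ i) UNIV" if "norm \<theta> \<le> sqrt r" for \<theta>
    unfolding shift
  proof (rule dissipative_loop.UGAOS_state[OF D sys[unfolded shift]])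
    have "(norm \<theta>)\<^sup>2 \<le> r" using power_mono[OF that norm_ge_zero, of 2] r by simp
    then show "\<mu> \<theta> = 0" by (simp add: \<mu>_def)
  qed (rule norm)
  have residual: "UGAOS (shifted_closed_loop f g \<phi> k w \<theta>) (\<lambda>\<xi>. h (fst \<xi>) (snd \<xi> + \<theta>) \<theta>) {..<m}"
    if h: "\<forall>i<m. continuous_on UNIV (\<lambda>(x, h\<theta>, \<theta>). h x h\<theta> \<theta> i)" and b: "class_K_inf b"
      and hb: "\<forall>x h\<theta> \<theta>. L2_set (h x h\<theta> \<theta>) {..<m}
        \<le> b (max ((norm (T (x, h\<theta>)))\<^sup>2 - inverse \<omega> * \<epsilon> * max ((norm \<theta>)\<^sup>2 - r) 0) 0)"
    for m :: nat and h :: "'n rvec \<Rightarrow> 'p rvec \<Rightarrow> 'p rvec \<Rightarrow> nat \<Rightarrow> real" and b and \<theta> :: "'p rvec"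
  proof -
    have bound: "L2_set (h x h\<theta> \<theta>) {..<m} \<le> b (max ((norm (T (x, h\<theta>)))\<^sup>2 - \<mu> \<theta> / \<omega>) 0)" for x h\<theta>
      using hb[rule_format, of x h\<theta> \<theta>] by (simp add: \<mu>_def divide_inverse mult_ac)
    have "output_system (shifted_closed_loop f g \<phi> k w \<theta>) (\<lambda>\<xi>. h (fst \<xi>) (snd \<xi> + \<theta>) \<theta>) {..<m}"
      unfolding shift
    proof (rule dissipative_loop.output_system_shift[OF D])
      fix i assume "i \<in> {..<m}"
      then have "continuous_on UNIV (\<lambda>(x, h\<theta>, \<theta>). h x h\<theta> \<theta> i)" using h by blast
      then have "continuous_on UNIV
          (\<lambda>\<xi>. case (fst \<xi>, snd \<xi> + \<theta>, \<theta>) of (x, h\<theta>, \<theta>) \<Rightarrow> h x h\<theta> \<theta> i)"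
        by (rule continuous_on_compose2) (auto intro!: continuous_intros)
      then show "continuous_on UNIV (\<lambda>\<xi>. h (fst \<xi>) (snd \<xi> + \<theta>) \<theta> i)" by simp
      have "T (0, \<theta>) = 0" using T by (simp add: smooth_diffeo_family_def)
      moreover have "\<mu> \<theta> / \<omega> \<ge> 0" using \<omega> \<epsilon> by (simp add: \<mu>_def)
      ultimately have "L2_set (h 0 \<theta> \<theta>) {..<m} \<le> 0"
        using bound[of 0 \<theta>] b by (simp add: class_K_inf_def max_absorb2)
      then have "L2_set (h 0 \<theta> \<theta>) {..<m} = 0" using L2_set_nonneg by (metis antisym)
      then show "h (fst 0) (snd 0 + \<theta>) \<theta> i = 0"
        using \<open>i \<in> {..<m}\<close> by (simp add: L2_set_eq_0_iff)
    qed simp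
    then show ?thesis
      unfolding shift by (rule dissipative_loop.UGAOS_residual_output[OF D _ b]) (use bound in auto)
  qed
  show ?thesis
  proof (rule exI[of _ k], rule exI[of _ w], rule exI[of _ T], intro conjI allI impI)
    fix \<theta> :: "'p rvec"
    show "forward_complete (closed_loop f g \<phi> k w \<theta>)"
      unfolding forward_complete_def using dissipative_loop.solution_exists[OF D] by blast
    show "lagrange_output_stable (shifted_closed_loop f g \<phi> k w \<theta>) (\<lambda>\<xi> i. fst \<xi> $ i) UNIV"
      using GAOS[of \<theta>] by (simp add: GAOS_def)
  next
    fix m :: nat and h :: "'n rvec \<Rightarrow> 'p rvec \<Rightarrow> 'p rvec \<Rightarrow> nat \<Rightarrow> real" and \<theta> :: "'p rvec"
    assume "(\<forall>i<m. continuous_on UNIV (\<lambda>(x, h\<theta>, \<theta>). h x h\<theta> \<theta> i)) \<and>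
        (\<exists>b. class_K_inf b \<and>
           (\<forall>x h\<theta> \<theta>. L2_set (h x h\<theta> \<theta>) {..<m}
              \<le> b (max ((norm (T (x, h\<theta>)))\<^sup>2 - inverse \<omega> * \<epsilon> * max ((norm \<theta>)\<^sup>2 - r) 0) 0)))"
    then show "UGAOS (shifted_closed_loop f g \<phi> k w \<theta>) (\<lambda>\<xi>. h (fst \<xi>) (snd \<xi> + \<theta>) \<theta>) {..<m}"
      using residual by blast
  qed (fact k w T lie GAOS | rule state dissipative_loop.equilibria_F[OF D]
      dissipative_loop.lyapunov_stable_state[OF D] dissipative_loop.solution_bounded[OF D]
      dissipative_loop.state_tendsto_zero[OF D], assumption?)+
qed

end
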